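(* Let $A,B\in\mathbb{R}$ with $-1\le B<A\le 1$ and let $0\le\alpha<1$. Then the equation $$\frac{r^2-4r+1}{1-r^2}-\frac{(A-B)r}{(1-A r)(1-B r)}-\alpha=0$$ has a unique root $r_c=r_c(A,B,\alpha)$ in $(0,1)$, and for every $f\in\mathcal{P}[A,B]$ and every $g\in\mathcal{U}$ the function $T_g[f]$ is convex of order $\alpha$ in the disk $|z|<r_c(A,B,\alpha)$. The radius $r_c(A,B,\alpha)$ is the best possible: it cannot be replaced by any larger radius common to all $f\in\mathcal{P}[A,B]$ and $g\in\mathcal{U}$.
   Context: Let $\mathbb{D}=\{z\in\mathbb{C}:|z|<1\}$, and let $\mathcal{A}$ be the class of functions $f$ analytic in $\mathbb{D}$ with $f(0)=0$, $f'(0)=1$; $\mathcal{U}\subset\mathcal{A}$ is the subclass of univalent (one-to-one) functions in $\mathbb{D}$. For analytic $f,g$ in $\mathbb{D}$, the Volterra-type integral operator is $T_g[f](z)=\int_0^z f(s)g'(s)\,ds$, $z\in\mathbb{D}$. For $F$ analytic in $\mathbb D$, "$F$ is convex of order $\alpha$ in the disk $|z|<r$" means $\mathrm{Re}\{1+zF''(z)/F'(z)\}>\alpha$ for all $|z|<r$. Subordination: $p\prec q$ means $p(z)=q(w(z))$ in $\mathbb{D}$ for some analytic $w$ on $\mathbb{D}$ with $w(0)=0$ and $|w(z)|\le 1$. $\mathcal{P}$ is the class of $p$ analytic in $\mathbb{D}$ with $p(0)=1$ and $\mathrm{Re}\,p(z)>0$ in $\mathbb{D}$. $\mathcal{P}[A,B]=\{p\in\mathcal{P}: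 p(z)\prec \frac{1+Az}{1+Bz}\}$. *)

theory Defs
  imports "HOL-Complex_Analysis.Complex_Analysis"
begin

abbreviation unit_disk :: "complex set" where
  "unit_disk \<equiv> ball 0 1"

definition class_A :: "(complex \<Rightarrow> complex) set" where
  "class_A = {f. f holomorphic_on unit_disk \<and> f 0 = 0 \<and> deriv f 0 = 1}"

definition class_U :: "(complex \<Rightarrow> complex) set" where
  "class_U = {f \<in> class_A. inj_on f unit_disk}"

definition subordinate :: "(complex \<Rightarrow> complex) \<Rightarrow> (complex \<Rightarrow> complex) \<Rightarrow> bool"
    (infix \<open>\<prec>\<close> 50) where
  "p \<prec> q \<longleftrightarrow> (\<exists>w. w holomorphic_on unit_disk \<and> w 0 = 0 \<and>
     (\<forall>z\<in>unit_disk. norm (w z) \<le> 1) \<and> (\<forall>z\<in>unit_disk. p z = q (w z)))"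

definition class_P :: "(complex \<Rightarrow> complex) set" where
  "class_P = {p. p holomorphic_on unit_disk \<and> p 0 = 1 \<and> (\<forall>z\<in>unit_disk. Re (p z) > 0)}"

definition class_PAB :: "real \<Rightarrow> real \<Rightarrow> (complex \<Rightarrow> complex) set" where
  "class_PAB A B =
     {p \<in> class_P. p \<prec> (\<lambda>z. (1 + of_real A * z) / (1 + of_real B * z))}"

definition volterra :: "(complex \<Rightarrow> complex) \<Rightarrow> (complex \<Rightarrow> complex) \<Rightarrow> complex \<Rightarrow> complex" where
  "volterra g f z = contour_integral (linepath 0 z) (\<lambda>s. f s * deriv g s)"

text \<open>The derivative is required not to vanish: the quotient would otherwise be undefined,
  whereas HOL's convention \<open>x / 0 = 0\<close> would make the inequality hold at such a point.\<close>

definition convex_of_order_in :: "real \<Rightarrow> real \<Rightarrow> (complex \<Rightarrow> complex) \<Rightarrow> bool" where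
  "convex_of_order_in \<alpha> r F \<longleftrightarrow>
     (\<forall>z\<in>ball 0 r. deriv F z \<noteq> 0 \<and> Re (1 + z * deriv (deriv F) z / deriv F z) > \<alpha>)"

definition radius_root :: "real \<Rightarrow> real \<Rightarrow> real \<Rightarrow> real \<Rightarrow> bool" where
  "radius_root A B \<alpha> r \<longleftrightarrow> 0 < r \<and> r < 1 \<and>
     (r^2 - 4 * r + 1) / (1 - r^2) - (A - B) * r / ((1 - A * r) * (1 - B * r)) - \<alpha> = 0"

definition radius_c :: "real \<Rightarrow> real \<Rightarrow> real \<Rightarrow> real" where
  "radius_c A B \<alpha> = (THE r. radius_root A B \<alpha> r)"

text \<open>The integral is analytic in the disk, so the derivatives in
  \<^const>\<open>convex_of_order_in\<close> are genuine ones there.\<close>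

lemma volterra_has_field_derivative:
  assumes "f holomorphic_on unit_disk" "g holomorphic_on unit_disk" "z \<in> unit_disk"
  shows "(volterra g f has_field_derivative f z * deriv g z) (at z)"
proof -
  have hol: "(\<lambda>s. f s * deriv g s) holomorphic_on unit_disk"
    using assms by (intro holomorphic_intros) auto
  obtain G where G: "\<And>x. x \<in> unit_disk \<Longrightarrow>
      (G has_field_derivative f x * deriv g x) (at x within unit_disk)"
    using holomorphic_convex_primitive'[OF convex_ball open_ball hol] by blast
  have eq: "volterra g f x = G x - G 0" if x: "x \<in> unit_disk" for x
  proof -
    have "path_image (linepath 0 x) \<subseteq> unit_disk"
      using x by (simp add: closed_segment_subset)
    then show ?thesis
      unfolding volterra_def
      using contour_integral_primitive[OF G, of "linepath 0 x"]
      by (simp add: contour_integral_unique)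
  qed
  have "((\<lambda>x. G x - G 0) has_field_derivative f z * deriv g z) (at z)"
    using G[OF assms(3)] assms(3) by (auto intro!: derivative_eq_intros simp: at_within_open[OF assms(3)])
  then show ?thesis
    by (rule has_field_derivative_transform_within_open[OF _ open_ball assms(3)]) (simp add: eq)
qed

lemma volterra_holomorphic:
  assumes "f holomorphic_on unit_disk" "g holomorphic_on unit_disk"
  shows "volterra g f holomorphic_on unit_disk"
  using volterra_has_field_derivative[OF assms]
  by (meson holomorphic_on_open open_ball)

end

theory Submission
  imports Defs
begin

text \<open>
  With \<open>F = T\<^sub>g[f]\<close> one has \<open>F' = f g'\<close>, so
  \<open>1 + z F''/F' = (1 + z g''/g') + z f'/f\<close>, and the two summands can be bounded separately at
  \<open>|z| = r\<close> by the two terms of the radius equation.  Both bounds are attained at the point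
  \<open>z = r\<close>, by \<open>g(z) = z/(1+z)\<^sup>2\<close> and \<open>f(z) = (1 - A z)/(1 - B z)\<close>, which gives the sharpness;
  the left-hand side of the equation decreases in \<open>r\<close>, which gives the unique root and the
  inequality inside the disk.

  The bound for \<open>g\<close> (\<open>univalent_convexity_bound\<close>) is the classical consequence of Bieberbach's
  \<open>|a\<^sub>2| \<le> 2\<close> and a disk automorphism.  Bieberbach's inequality is proved here without the area
  theorem, from the positivity of logarithmic energy.  For an injective \<open>h(z) = z + ...\<close> the
  function \<open>-log |h(z) - h(\<zeta>)|\<close> is a conditionally positive definite kernel, because up to terms
  in one variable it is half of \<open>-log (1 - X\<cdot>Y)\<close>, where \<open>X\<close> and \<open>Y\<close> are the
  stereographic images of \<open>h(z)\<close> and \<open>h(\<zeta>)\<close> on the unit sphere, and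
  \<open>-log (1 - \<kappa>) = \<Sum> \<kappa>\<^sup>n/n\<close>.  On a circle it differs from the explicit kernel \<open>-log |z - \<zeta>|\<close> by the
  real part of a function analytic in both variables.  Testing the positivity with
  \<open>cos (\<theta> + \<beta>)\<close> therefore bounds one Taylor coefficient of the latter
  (\<open>grunsky_first_coefficient\<close>), and for the square root transform of \<open>g\<close> this coefficient is
  \<open>a\<^sub>2/2\<close>.

  The bound for \<open>f = (1 + A w)/(1 + B w)\<close> (\<open>class_PAB_log_derivative_bound\<close>) rests on
  \<open>z f'/f = \<integral>\<^sub>B\<^sup>A z w'/(1 + t w)\<^sup>2 dt\<close>.  The real part of each integrand is at least its value
  \<open>-r/(1 - t r)\<^sup>2\<close> for \<open>w(z) = -z\<close> and \<open>z = r\<close>, as long as \<open>r \<le> 2 - \<surd>3\<close>, that is \<open>r\<^sup>2 - 4 r + 1 \<ge> 0\<close>.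
  For larger radii the bound can fail, but \<open>\<alpha> \<ge> 0\<close> keeps the root of the equation below
  \<open>2 - \<surd>3\<close>.
\<close>

section \<open>Positive definiteness of the logarithmic kernel\<close>

text \<open>
  A power of an inner product is again an inner product, of tensor powers.  In coordinates: expanding
  one factor \<open>X x \<bullet> X y\<close> turns the integral for \<open>c\<close> into a sum of integrals with exponent \<open>n\<close>
  for the weights \<open>c\<cdot>(X \<bullet> i)\<close>, which is why the induction is over all weights.
\<close>
lemma power_inner_kernel_nonneg:
  fixes X :: "real \<Rightarrow> 'a::euclidean_space" and c :: "real \<Rightarrow> real"
  assumes X: "continuous_on {a..b} X" and c: "continuous_on {a..b} c"
  shows "0 \<le> integral (cbox (a, a) (b, b)) (\<lambda>(x, y). c x * c y * (X x \<bullet> X y) ^ n)"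
  using c
proof (induction n arbitrary: c)
  case 0
  have "continuous_on (cbox (a, a) (b, b)) (\<lambda>(x, y). c x * c y)"
    unfolding case_prod_unfold cbox_Pair_eq cbox_interval
    by (intro continuous_intros continuous_on_compose2[OF 0]) auto
  from integral_prod_continuous[OF this]
  have "integral (cbox (a, a) (b, b)) (\<lambda>(x, y). c x * c y) = (integral {a..b} c)\<^sup>2"
    by (simp add: power2_eq_square)
  then show ?case by simp
next
  case (Suc n)
  have int: "(\<lambda>(x, y). (c x * (X x \<bullet> i)) * (c y * (X y \<bullet> i)) * (X x \<bullet> X y) ^ n)
      integrable_on cbox (a, a) (b, b)" for i :: 'a
    unfolding case_prod_unfold
    by (rule integrable_continuous, unfold cbox_Pair_eq cbox_interval)
       (intro continuous_intros continuous_on_compose2[OF Suc.prems] continuous_on_compose2[OF X]; auto)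
  have "c x * c y * (X x \<bullet> X y) ^ Suc n =
      (\<Sum>i\<in>Basis. (c x * (X x \<bullet> i)) * (c y * (X y \<bullet> i)) * (X x \<bullet> X y) ^ n)" for x y
  proof -
    have "c x * c y * (X x \<bullet> X y) ^ Suc n = c x * c y * (X x \<bullet> X y) ^ n * (X x \<bullet> X y)"
      by simp
    also have "\<dots> = c x * c y * (X x \<bullet> X y) ^ n * (\<Sum>i\<in>Basis. (X x \<bullet> i) * (X y \<bullet> i))"
      by (subst (2) euclidean_inner) simp
    also have "\<dots> = (\<Sum>i\<in>Basis. (c x * (X x \<bullet> i)) * (c y * (X y \<bullet> i)) * (X x \<bullet> X y) ^ n)"
      by (simp add: sum_distrib_left mult_ac)
    finally show ?thesis .
  qed
  then have "integral (cbox (a, a) (b, b)) (\<lambda>(x, y). c x * c y * (X x \<bullet> X y) ^ Suc n) =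
     integral (cbox (a, a) (b, b)) (\<lambda>p. \<Sum>i\<in>Basis. (\<lambda>(x, y). (c x * (X x \<bullet> i)) * (c y * (X y \<bullet> i)) * (X x \<bullet> X y) ^ n) p)"
    by (intro arg_cong[of _ _ "integral _"]) (auto simp: fun_eq_iff)
  also have "\<dots> = (\<Sum>i\<in>Basis. integral (cbox (a, a) (b, b))
      (\<lambda>(x, y). (c x * (X x \<bullet> i)) * (c y * (X y \<bullet> i)) * (X x \<bullet> X y) ^ n))"
    by (rule integral_sum) (use int in auto)
  also have "\<dots> \<ge> 0"
    by (intro sum_nonneg Suc.IH continuous_intros Suc.prems X)
  finally show ?case .
qed

text \<open>
  Integrate \<open>-ln (1 - \<kappa>) = \<Sum> \<kappa>\<^sup>k/k\<close> termwise; the bound \<open>q < 1\<close> makes the convergence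
  dominated.
\<close>
lemma log_kernel_nonneg:
  fixes X :: "real \<Rightarrow> 'a::euclidean_space" and c :: "real \<Rightarrow> real"
  assumes X: "continuous_on {a..b} X" and c: "continuous_on {a..b} c"
    and q: "\<And>x. x \<in> {a..b} \<Longrightarrow> norm (X x) \<le> q" "q < 1"
  shows "0 \<le> integral (cbox (a, a) (b, b)) (\<lambda>(x, y). c x * c y * - ln (1 - X x \<bullet> X y))"
proof (cases "a \<le> b")
  case False
  then have "cbox (a, a) (b, b) = {}"
    by (simp add: cbox_Pair_eq)
  then show ?thesis by simp
next
  case True
  then have "0 \<le> q" using q(1)[of a] order_trans[OF norm_ge_zero] by auto
  then have q2: "q\<^sup>2 < 1" using q(2) by (simp add: power_less_one_iff)
  have \<kappa>: "\<bar>X x \<bullet> X y\<bar> \<le> q\<^sup>2" if "x \<in> {a..b}" "y \<in> {a..b}" for x y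
  proof -
    have "\<bar>X x \<bullet> X y\<bar> \<le> norm (X x) * norm (X y)" by (rule Cauchy_Schwarz_ineq2)
    also have "\<dots> \<le> q * q" using q(1) that \<open>0 \<le> q\<close> by (intro mult_mono) auto
    finally show ?thesis by (simp add: power2_eq_square)
  qed
  obtain C where C: "\<And>x. x \<in> {a..b} \<Longrightarrow> \<bar>c x\<bar> \<le> C"
    using compact_imp_bounded[OF compact_continuous_image[OF c compact_Icc]]
    unfolding bounded_iff by (metis imageI real_norm_def)
  then have C0: "0 \<le> C" using True order_trans[OF abs_ge_zero, of "c a" C] by auto
  define S where "S = (\<lambda>n (x, y). \<Sum>k<n. c x * c y * (X x \<bullet> X y) ^ k / real k)"
  have int: "(\<lambda>(x, y). c x * c y * (X x \<bullet> X y) ^ k / real k) integrable_on cbox (a, a) (b, b)" for k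
    unfolding case_prod_unfold divide_inverse
    by (rule integrable_continuous, unfold cbox_Pair_eq cbox_interval)
       (intro continuous_intros continuous_on_compose2[OF c] continuous_on_compose2[OF X]; auto)
  have S: "S n = (\<lambda>p. \<Sum>k<n. (\<lambda>(x, y). c x * c y * (X x \<bullet> X y) ^ k / real k) p)" for n
    by (auto simp: S_def fun_eq_iff)
  have lim: "(\<lambda>n. integral (cbox (a, a) (b, b)) (S n)) \<longlonglongrightarrow>
      integral (cbox (a, a) (b, b)) (\<lambda>(x, y). c x * c y * - ln (1 - X x \<bullet> X y))"
  proof (rule dominated_convergence(2))
    show "S n integrable_on cbox (a, a) (b, b)" for n
      unfolding S by (intro integrable_sum int) auto
    show "(\<lambda>_. C * C * (1 / (1 - q\<^sup>2))) integrable_on cbox (a, a) (b, b)"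
      by (rule integrable_const)
  next
    fix n p assume "p \<in> cbox (a, a) (b, b)"
    then obtain x y where p: "p = (x, y)" "x \<in> {a..b}" "y \<in> {a..b}"
      by (cases p) (auto simp: cbox_Pair_eq)
    have "norm (S n p) \<le> (\<Sum>k<n. norm (c x * c y * (X x \<bullet> X y) ^ k / real k))"
      unfolding S_def p prod.case real_norm_def by (rule sum_abs)
    also have "\<dots> \<le> (\<Sum>k<n. C * C * (q\<^sup>2) ^ k)"
    proof (rule sum_mono)
      fix k :: nat
      have "1 / real k \<le> 1" by (cases k) auto
      have "norm (c x * c y * (X x \<bullet> X y) ^ k / real k) = \<bar>c x\<bar> * \<bar>c y\<bar> * \<bar>X x \<bullet> X y\<bar> ^ k * (1 / real k)"
        by (simp add: abs_mult power_abs)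
      also have "\<dots> \<le> C * C * (q\<^sup>2) ^ k * 1"
        using C p \<kappa> C0 \<open>1 / real k \<le> 1\<close> by (intro mult_mono power_mono) auto
      finally show "norm (c x * c y * (X x \<bullet> X y) ^ k / real k) \<le> C * C * (q\<^sup>2) ^ k" by simp
    qed
    also have "\<dots> = C * C * (\<Sum>k<n. (q\<^sup>2) ^ k)" by (simp add: sum_distrib_left)
    also have "\<dots> \<le> C * C * (1 / (1 - q\<^sup>2))"
      using q2 C0 sum_le_suminf[of "\<lambda>k. (q\<^sup>2) ^ k" "{..<n}"] 
      by (intro mult_left_mono) (auto simp: suminf_geometric summable_geometric)
    finally show "norm (S n p) \<le> C * C * (1 / (1 - q\<^sup>2))" .
  next
    fix p assume "p \<in> cbox (a, a) (b, b)"
    then obtain x y where p: "p = (x, y)" "x \<in> {a..b}" "y \<in> {a..b}"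
      by (cases p) (auto simp: cbox_Pair_eq)
    have "\<bar>- (X x \<bullet> X y)\<bar> < 1" using \<kappa>[OF p(2,3)] q2 by simp
    from sums_mult[OF ln_series'[OF this], of "- (c x * c y)"]
    have "(\<lambda>k. c x * c y * (X x \<bullet> X y) ^ k / real k) sums (c x * c y * - ln (1 - X x \<bullet> X y))"
      by simp
    then show "(\<lambda>n. S n p) \<longlonglongrightarrow> (\<lambda>(x, y). c x * c y * - ln (1 - X x \<bullet> X y)) p"
      unfolding sums_def S_def p by simp
  qed
  moreover have "0 \<le> integral (cbox (a, a) (b, b)) (S n)" for n
  proof -
    have "0 \<le> integral (cbox (a, a) (b, b)) (\<lambda>(x, y). c x * c y * (X x \<bullet> X y) ^ k / real k)" for k
    proof -
      have "integral (cbox (a, a) (b, b)) (\<lambda>p. (\<lambda>(x, y). c x * c y * (X x \<bullet> X y) ^ k) p / real k)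
         = integral (cbox (a, a) (b, b)) (\<lambda>(x, y). c x * c y * (X x \<bullet> X y) ^ k) / real k"
        by (rule integral_divide)
      then show ?thesis
        using power_inner_kernel_nonneg[OF X c, of k] by (simp add: case_prod_unfold)
    qed
    then show ?thesis
      unfolding S by (subst integral_sum) (auto intro!: sum_nonneg int simp del: case_prod_conv)
  qed
  ultimately show ?thesis
    by (intro LIMSEQ_le_const[OF lim]) auto
qed

section \<open>Cosine integrals over circles\<close>

text \<open>
  Writing the cosine as half the sum of \<open>cis (x + \<beta>)\<close> and its inverse, the first part is an integral
  of \<open>F\<close> over the circle, which vanishes, and the second one is Cauchy's formula for \<open>F' 0\<close>.
\<close>
lemma circle_integral_cos:
  fixes F :: "complex \<Rightarrow> complex"
  assumes F: "F holomorphic_on ball 0 R" and \<rho>: "0 < \<rho>" "\<rho> < R"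
  shows "((\<lambda>x. Re (F (of_real \<rho> * cis x)) * cos (x + \<beta>)) has_integral
      Re (of_real (pi * \<rho>) * cis (- \<beta>) * deriv F 0)) {0..2 * pi}"
proof -
  let ?e = "\<lambda>x. of_real \<rho> * cis x"
  have hol: "F holomorphic_on cball 0 \<rho>" "continuous_on (cball 0 \<rho>) F" "F holomorphic_on ball 0 \<rho>"
    using F \<rho> by (auto intro!: holomorphic_on_imp_continuous_on intro: holomorphic_on_subset)
  have "(F has_contour_integral 0) (part_circlepath 0 \<rho> 0 (2 * pi))"
    unfolding circlepath_def[symmetric]
    by (rule Cauchy_theorem_disc_simple[OF F]) (use \<rho> in auto)
  then have 1: "((\<lambda>x. F (?e x) * (of_real \<rho> * \<i> * cis x)) has_integral 0) {0..2 * pi}"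
    by (subst (asm) has_contour_integral_part_circlepath_iff) (auto simp: mult_ac)
  have "((\<lambda>u. F u / (u - 0) ^ Suc 1) has_contour_integral (2 * pi * \<i>) / fact 1 * (deriv ^^ 1) F 0)
      (part_circlepath 0 \<rho> 0 (2 * pi))"
    unfolding circlepath_def[symmetric]
    by (rule Cauchy_has_contour_integral_higher_derivative_circlepath) (use hol \<rho> in auto)
  then have "((\<lambda>x. F (0 + ?e x) / (0 + ?e x - 0) ^ Suc 1 * of_real \<rho> * \<i> * cis x) has_integral
      (2 * pi * \<i>) / fact 1 * (deriv ^^ 1) F 0) {0..2 * pi}"
    by (subst (asm) has_contour_integral_part_circlepath_iff) auto
  from has_integral_eq[OF _ this] have 2: "((\<lambda>x. F (?e x) / (?e x)\<^sup>2 * (of_real \<rho> * \<i> * cis x)) has_integral 2 * pi * \<i> * deriv F 0) {0..2 * pi}"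
    by (simp add: power2_eq_square mult.assoc)
  have "((\<lambda>x. F (?e x) * (of_real \<rho> * \<i> * cis x) * (cis \<beta> / (2 * of_real \<rho> * \<i>)) +
      F (?e x) / (?e x)\<^sup>2 * (of_real \<rho> * \<i> * cis x) * (of_real \<rho> * cis (- \<beta>) / (2 * \<i>))) has_integral
      0 * (cis \<beta> / (2 * of_real \<rho> * \<i>)) + 2 * pi * \<i> * deriv F 0 * (of_real \<rho> * cis (- \<beta>) / (2 * \<i>))) {0..2 * pi}"
    by (intro has_integral_add has_integral_mult_left 1 2)
  also have "(\<lambda>x. F (?e x) * (of_real \<rho> * \<i> * cis x) * (cis \<beta> / (2 * of_real \<rho> * \<i>)) +
      F (?e x) / (?e x)\<^sup>2 * (of_real \<rho> * \<i> * cis x) * (of_real \<rho> * cis (- \<beta>) / (2 * \<i>))) =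
      (\<lambda>x. F (?e x) * of_real (cos (x + \<beta>)))"
  proof
    fix x
    have c: "of_real (cos (x + \<beta>)) = (cis x * cis \<beta> + inverse (cis x) * cis (-\<beta>)) / 2"
      using cos_minus[of "x + \<beta>"] sin_minus[of "x + \<beta>"] by (simp add: cis_mult complex_eq_iff)
    have "cis x \<noteq> 0" by simp
    show "F (?e x) * (of_real \<rho> * \<i> * cis x) * (cis \<beta> / (2 * of_real \<rho> * \<i>)) +
      F (?e x) / (?e x)\<^sup>2 * (of_real \<rho> * \<i> * cis x) * (of_real \<rho> * cis (- \<beta>) / (2 * \<i>)) = F (?e x) * of_real (cos (x + \<beta>))"
      unfolding c using \<rho> \<open>cis x \<noteq> 0\<close> by (simp add: field_simps power2_eq_square)
  qed
  also have "0 * (cis \<beta> / (2 * of_real \<rho> * \<i>)) + 2 * pi * \<i> * deriv F 0 * (of_real \<rho> * cis (- \<beta>) / (2 * \<i>))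
      = of_real (pi * \<rho>) * cis (- \<beta>) * deriv F 0"
    by (simp add: field_simps)
  finally have "((\<lambda>x. Re (F (?e x) * of_real (cos (x + \<beta>)))) has_integral
     Re (of_real (pi * \<rho>) * cis (- \<beta>) * deriv F 0)) {0..2 * pi}"
    by (rule has_integral_Re)
  then show ?thesis by simp
qed

section \<open>The first Grunsky inequality\<close>

text \<open>
  The mean of \<open>h'\<close> over the segment from \<open>w\<close> to \<open>z\<close> is jointly continuous in the two
  points, including the diagonal, since it is an integral depending on parameters.
\<close>
lemma holomorphic_difference_quotient:
  assumes h: "h holomorphic_on S" and S: "open S" "convex S"
  obtains q where "continuous_on (S \<times> S) (\<lambda>(z, w). q z w)"
    and "\<And>z w. z \<in> S \<Longrightarrow> w \<in> S \<Longrightarrow> h z - h w = (z - w) * q z w"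
    and "\<And>z. q z z = deriv h z"
proof
  define q where "q z w = integral {0..1} (\<lambda>t. deriv h (w + of_real t * (z - w)))" for z w
  have seg: "w + of_real t * (z - w) \<in> S" if "z \<in> S" "w \<in> S" "t \<in> {0..1}" for z w t
  proof -
    have "w + of_real t * (z - w) = (1 - t) *\<^sub>R w + t *\<^sub>R z"
      by (simp add: scaleR_conv_of_real algebra_simps)
    then show ?thesis using convexD_alt[OF S(2) that(2,1)] that(3) by simp
  qed
  have cont: "continuous_on S (deriv h)"
    using holomorphic_deriv[OF h S(1)] holomorphic_on_imp_continuous_on by blast
  have "continuous_on ((S \<times> S) \<times> cbox 0 (1::real))
      (\<lambda>(p, t). deriv h (snd p + of_real t * (fst p - snd p)))"
    unfolding case_prod_unfold
    by (intro continuous_on_compose2[OF cont] continuous_intros) (auto intro!: seg)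
  from integral_continuous_on_param[OF this]
  show "continuous_on (S \<times> S) (\<lambda>(z, w). q z w)"
    by (simp add: q_def case_prod_unfold)
  show "q z z = deriv h z" for z
    by (simp add: q_def)
  show "h z - h w = (z - w) * q z w" if zw: "z \<in> S" "w \<in> S" for z w
  proof -
    have D: "(h has_field_derivative deriv h (w + of_real t * (z - w))) (at (w + of_real t * (z - w)))"
      if "t \<in> {0..1}" for t
      using holomorphic_derivI[OF h S(1)] seg[OF zw that] by blast
    have "((\<lambda>t. deriv h (w + of_real t * (z - w)) * (z - w)) has_integral
       (h (w + of_real 1 * (z - w)) - h (w + of_real 0 * (z - w)))) {0..1}"
    proof (rule fundamental_theorem_of_calculus)
      fix t :: real assume t: "t \<in> {0..1}"
      have "((\<lambda>t. w + of_real t * (z - w)) has_vector_derivative (z - w)) (at t within {0..1})"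
        by (auto intro!: derivative_eq_intros)
      from field_vector_diff_chain_within[OF this has_field_derivative_at_within[OF D[OF t]]]
      show "((\<lambda>t. h (w + of_real t * (z - w))) has_vector_derivative
          deriv h (w + of_real t * (z - w)) * (z - w)) (at t within {0..1})"
        by (simp add: o_def mult.commute)
    qed simp
    from integral_unique[OF this] show ?thesis
      by (simp add: q_def mult.commute)
  qed
qed

text \<open>Inverse stereographic projection onto the unit sphere of \<open>complex \<times> real\<close>.\<close>
definition sphere_point :: "complex \<Rightarrow> complex \<times> real" where
  "sphere_point w = ((2 / (1 + (cmod w)\<^sup>2)) *\<^sub>R w, ((cmod w)\<^sup>2 - 1) / (1 + (cmod w)\<^sup>2))"

text \<open>
  Up to factors in one variable, \<open>1 - X \<bullet> Y\<close> is the squared Euclidean distance of the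
  projected points, so its logarithm is the logarithmic kernel of the plane up to terms that are
  annihilated by weights of mean zero.
\<close>
lemma sphere_point_inner:
  "sphere_point u \<bullet> sphere_point w = 1 - 2 * (cmod (u - w))\<^sup>2 / ((1 + (cmod u)\<^sup>2) * (1 + (cmod w)\<^sup>2))"
proof -
  have pos: "1 + (cmod u)\<^sup>2 \<noteq> 0" "1 + (cmod w)\<^sup>2 \<noteq> 0"
    by (metis add_pos_nonneg less_numeral_extra(1,3) zero_le_power2)+
  have e: "(cmod (u - w))\<^sup>2 = (cmod u)\<^sup>2 + (cmod w)\<^sup>2 - 2 * (u \<bullet> w)"
    by (simp add: power2_norm_eq_inner inner_diff_left inner_diff_right inner_commute)
  have "sphere_point u \<bullet> sphere_point w = 
     (4 * (u \<bullet> w) + ((cmod u)\<^sup>2 - 1) * ((cmod w)\<^sup>2 - 1)) / ((1 + (cmod u)\<^sup>2) * (1 + (cmod w)\<^sup>2))"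
    by (simp add: sphere_point_def add_divide_distrib)
  also have "\<dots> = 1 - 2 * (cmod (u - w))\<^sup>2 / ((1 + (cmod u)\<^sup>2) * (1 + (cmod w)\<^sup>2))"
  proof -
    have "4 * (u \<bullet> w) + ((cmod u)\<^sup>2 - 1) * ((cmod w)\<^sup>2 - 1) =
        (1 + (cmod u)\<^sup>2) * (1 + (cmod w)\<^sup>2) - 2 * (cmod (u - w))\<^sup>2"
      unfolding e by (simp add: algebra_simps)
    then show ?thesis using pos by (simp add: diff_divide_distrib)
  qed
  finally show ?thesis .
qed

lemma norm_sphere_point: "norm (sphere_point w) = 1"
  by (simp add: norm_eq_sqrt_inner sphere_point_inner)

lemma continuous_on_sphere_point [continuous_intros]:
  assumes "continuous_on A f"
  shows "continuous_on A (\<lambda>x. sphere_point (f x))"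
proof -
  have "1 + (cmod w)\<^sup>2 \<noteq> 0" for w
    by (metis add_pos_nonneg less_numeral_extra(1,3) zero_le_power2)
  then show ?thesis
    unfolding sphere_point_def by (intro continuous_intros assms) auto
qed

lemma negligible_cis_diagonal:
  "negligible {p \<in> cbox (0, 0) (2 * pi, 2 * pi). cis (fst p) = cis (snd p)}"
proof (rule negligible_subset)
  let ?L = "\<lambda>b. {p :: real \<times> real. (1, -1) \<bullet> p = b}"
  show "negligible (?L 0 \<union> ?L (2 * pi) \<union> ?L (- 2 * pi))"
    by (intro negligible_Un negligible_hyperplane) (auto simp: zero_prod_def)
  show "{p \<in> cbox (0, 0) (2 * pi, 2 * pi). cis (fst p) = cis (snd p)} \<subseteq> ?L 0 \<union> ?L (2 * pi) \<union> ?L (- 2 * pi)"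
  proof
    fix p assume "p \<in> {p \<in> cbox (0, 0) (2 * pi, 2 * pi). cis (fst p) = cis (snd p)}"
    then obtain x y where p: "p = (x, y)" "0 \<le> x" "x \<le> 2 * pi" "0 \<le> y" "y \<le> 2 * pi" "cis x = cis y"
      by (cases p) (auto simp: cbox_Pair_eq)
    from p(6) have "sin x = sin y" "cos x = cos y" by (auto simp: complex_eq_iff)
    then obtain n where n: "x = y + 2 * pi * of_int n"
      using sin_cos_eq_iff[of x y] by auto
    have "(2 * pi) * of_int n \<le> (2 * pi) * 1" "(2 * pi) * - 1 \<le> (2 * pi) * of_int n"
      using n p(2-5) by linarith+
    then have "of_int n \<le> (1::real)" "- 1 \<le> (of_int n::real)"
      by (simp_all only: mult_le_cancel_left_pos[of "2 * pi"] pi_gt_zero zero_less_mult_iff zero_less_numeral simp_thms)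
    then have "n \<in> {-1, 0, 1}" by auto
    then show "p \<in> ?L 0 \<union> ?L (2 * pi) \<union> ?L (- 2 * pi)"
      using n p by auto
  qed
qed

text \<open>
  The quotient \<open>(h z - h \<zeta>)/(z - \<zeta>)\<close> has no zeros in the disk, by injectivity and
  \<open>h' \<zeta> \<noteq> 0\<close>, hence it has a holomorphic logarithm there; the right-hand side contains the
  derivative of this logarithm at \<open>0\<close>.
\<close>
lemma log_quotient_circle_integral:
  assumes h: "h holomorphic_on ball 0 1" "inj_on h (ball 0 1)" "h 0 = 0" "deriv h 0 = 1"
    and q: "\<And>z w. z \<in> ball 0 1 \<Longrightarrow> w \<in> ball 0 1 \<Longrightarrow> h z - h w = (z - w) * q z w"
      "\<And>z. q z z = deriv h z"
    and \<zeta>: "\<zeta> \<in> ball 0 1" "\<zeta> \<noteq> 0" and \<rho>: "0 < \<rho>" "\<rho> < 1"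
  shows "((\<lambda>y. ln (cmod (q (of_real \<rho> * cis y) \<zeta>)) * cos (y + \<beta>)) has_integral
      Re (of_real (pi * \<rho>) * cis (- \<beta>) * (1 / \<zeta> - 1 / h \<zeta>))) {0..2 * pi}"
proof -
  let ?Q = "\<lambda>z. q z \<zeta>"
  have Qeq: "?Q z = (h z - h \<zeta>) / (z - \<zeta>)" if "z \<in> ball 0 1" "z \<noteq> \<zeta>" for z
    using q(1)[OF that(1) \<zeta>(1)] that(2) by simp
  have "?Q holomorphic_on ball 0 1"
    using pole_lemma_open[OF h(1) open_ball, of \<zeta>]
    by (rule holomorphic_transform) (use Qeq q(2) in auto)
  moreover have Qnz: "?Q z \<noteq> 0" if z: "z \<in> ball 0 1" for z
  proof (cases "z = \<zeta>")
    case True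
    then show ?thesis
      using holomorphic_injective_imp_regular[OF h(1) open_ball h(2) \<zeta>(1)] q(2) by simp
  next
    case False
    then show ?thesis using q(1)[OF z \<zeta>(1)] inj_onD[OF h(2) _ z \<zeta>(1)] by force
  qed
  ultimately obtain L where L: "L holomorphic_on ball 0 1" "\<And>z. z \<in> ball 0 1 \<Longrightarrow> ?Q z = exp (L z)"
    using contractible_imp_holomorphic_log[of ?Q "ball 0 1"] convex_imp_contractible[OF convex_ball] by blast
  have hz: "h \<zeta> \<noteq> 0"
    using inj_onD[OF h(2), of \<zeta> 0] h(3) \<zeta> by auto
  have "((\<lambda>z. exp (L z)) has_field_derivative exp (L 0) * deriv L 0) (at 0)"
    using holomorphic_derivI[OF L(1) open_ball, of 0] by (auto intro!: derivative_eq_intros)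
  then have D1: "(?Q has_field_derivative ?Q 0 * deriv L 0) (at 0)"
    using has_field_derivative_transform_within_open[of "\<lambda>z. exp (L z)" _ 0 "ball 0 1" ?Q] L(2) by simp
  have h0: "(h has_field_derivative 1) (at 0)"
    using holomorphic_derivI[OF h(1) open_ball, of 0] h(4) by simp
  have "((\<lambda>z. (h z - h \<zeta>) / (z - \<zeta>)) has_field_derivative (1 * (0 - \<zeta>) - (h 0 - h \<zeta>) * 1) / ((0 - \<zeta>) * (0 - \<zeta>))) (at 0)"
    by (rule derivative_eq_intros h0 refl | use \<zeta> in simp)+
  then have D2: "(?Q has_field_derivative (h \<zeta> - \<zeta>) / \<zeta>\<^sup>2) (at 0)"
    using \<zeta> h(3) by (auto simp: power2_eq_square intro!: has_field_derivative_transform_within_open[where f = "\<lambda>z. (h z - h \<zeta>) / (z - \<zeta>)" and S = "ball 0 1 - {\<zeta>}"] Qeq[symmetric])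
  have "deriv L 0 = (h \<zeta> - \<zeta>) / \<zeta>\<^sup>2 / ?Q 0"
    using DERIV_unique[OF D1 D2] Qnz[of 0] 
    by (subst nonzero_eq_divide_eq) (auto simp: mult.commute)
  also have "\<dots> = 1 / \<zeta> - 1 / h \<zeta>"
    using Qeq[of 0] \<zeta> h(3) hz by (simp add: field_simps power2_eq_square)
  finally have dL: "deriv L 0 = 1 / \<zeta> - 1 / h \<zeta>" .
  have "ln (cmod (q (of_real \<rho> * cis y) \<zeta>)) = Re (L (of_real \<rho> * cis y))" for y
    using L(2)[of "of_real \<rho> * cis y"] \<rho> by (simp add: norm_mult)
  then show ?thesis
    using circle_integral_cos[OF L(1) \<rho>, of \<beta>] dL by simp
qed

lemma log_circle_integral:
  assumes \<tau>: "0 < \<tau>" "\<tau> < 1"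
  shows "((\<lambda>y. ln (cmod (1 - of_real \<tau> * cis (y - x))) * cos (y + \<beta>)) has_integral
      - pi * \<tau> * cos (x + \<beta>)) {0..2 * pi}"
proof -
  let ?F = "\<lambda>z. Ln (1 - of_real \<tau> * cis (- x) * z)"
  have pos: "0 < Re (1 - of_real \<tau> * cis (- x) * z)" if "z \<in> ball 0 (1 / \<tau>)" for z
  proof -
    have "Re (of_real \<tau> * cis (- x) * z) \<le> cmod (of_real \<tau> * cis (- x) * z)"
      by (rule complex_Re_le_cmod)
    also have "\<dots> < 1" using that \<tau> by (simp add: norm_mult field_simps)
    finally show ?thesis by simp
  qed
  then have nz: "1 - of_real \<tau> * cis (- x) * z \<notin> \<real>\<^sub>\<le>\<^sub>0" if "z \<in> ball 0 (1 / \<tau>)" for z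
    using that by (force simp: complex_nonpos_Reals_iff)
  have hol: "?F holomorphic_on ball 0 (1 / \<tau>)"
    by (intro holomorphic_intros nz)
  have "(?F has_field_derivative - (of_real \<tau> * cis (- x))) (at 0)"
    by (auto intro!: derivative_eq_intros)
  then have d: "deriv ?F 0 = - (of_real \<tau> * cis (- x))" by (rule DERIV_imp_deriv)
  have "Re (?F (of_real 1 * cis y)) = ln (cmod (1 - of_real \<tau> * cis (y - x)))" for y
  proof -
    have "1 - of_real \<tau> * cis (- x) * cis y \<noteq> 0"
    proof
      assume "1 - of_real \<tau> * cis (- x) * cis y = 0"
      moreover have "0 < Re (1 - of_real \<tau> * cis (- x) * cis y)" using pos[of "cis y"] \<tau> by simp
      ultimately show False by (simp only: zero_complex.sel less_irrefl)
    qed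
    then show ?thesis by (simp add: cis_mult mult.assoc)
  qed
  moreover have "Re (of_real (pi * 1) * cis (- \<beta>) * deriv ?F 0) = - pi * \<tau> * cos (x + \<beta>)"
  proof -
    have "of_real (pi * 1) * cis (- \<beta>) * deriv ?F 0 = of_real (- pi * \<tau>) * cis (- (x + \<beta>))"
    proof -
      have "cis (- (x + \<beta>)) = cis (- \<beta>) * cis (- x)" by (simp add: cis_mult algebra_simps)
      then show ?thesis unfolding d by (simp add: mult_ac)
    qed
    then show ?thesis using cos_minus[of "x + \<beta>"] by simp
  qed
  ultimately show ?thesis
    using circle_integral_cos[OF hol, of 1 \<beta>] \<tau> by simp
qed

text \<open>
  The two arguments of \<open>ln\<close> are the regularised kernels of the image points and of the circle.
  Both degenerate as \<open>\<epsilon> \<rightarrow> 0\<close> and \<open>v \<rightarrow> 0\<close>, but their ratio stays between constants; this is the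
  dominating function for the passage to the limit.
\<close>
lemma log_kernel_ratio_bound:
  fixes \<epsilon> v m m0 m1 :: real
  assumes \<epsilon>: "0 < \<epsilon>" "\<epsilon> < 1" and v: "0 \<le> v" and m: "0 < m0" "m0 \<le> m" "m \<le> m1"
  shows "\<bar>ln (\<epsilon>\<^sup>2 + (1 - \<epsilon>\<^sup>2) * (v * m)) - ln (\<epsilon>\<^sup>2 + (1 - \<epsilon>) * v)\<bar> \<le> \<bar>ln (min 1 m0)\<bar> + \<bar>ln (max 1 (2 * m1))\<bar>"
proof -
  let ?V = "\<epsilon>\<^sup>2 + (1 - \<epsilon>) * v" and ?W = "\<epsilon>\<^sup>2 + (1 - \<epsilon>\<^sup>2) * (v * m)"
  have V: "0 < ?V" using \<epsilon> v by (simp add: add_pos_nonneg)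
  have fac: "(1 - \<epsilon>\<^sup>2) = (1 - \<epsilon>) * (1 + \<epsilon>)" by (simp add: algebra_simps power2_eq_square)
  have p: "0 \<le> (1 - \<epsilon>) * v" using \<epsilon> v by simp
  have lo: "min 1 m0 * ?V \<le> ?W"
  proof -
    have "min 1 m0 * \<epsilon>\<^sup>2 \<le> 1 * \<epsilon>\<^sup>2" by (intro mult_right_mono) auto
    moreover have "((1 - \<epsilon>) * v) * min 1 m0 \<le> ((1 - \<epsilon>) * v) * ((1 + \<epsilon>) * m)"
    proof (rule mult_left_mono[OF _ p])
      have "min 1 m0 \<le> 1 * m" using m by auto
      also have "\<dots> \<le> (1 + \<epsilon>) * m" using \<epsilon> m by (intro mult_right_mono) auto
      finally show "min 1 m0 \<le> (1 + \<epsilon>) * m" .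
    qed
    ultimately show ?thesis unfolding fac by (simp add: algebra_simps)
  qed
  have hi: "?W \<le> max 1 (2 * m1) * ?V"
  proof -
    have "1 * \<epsilon>\<^sup>2 \<le> max 1 (2 * m1) * \<epsilon>\<^sup>2" by (intro mult_right_mono) auto
    moreover have "((1 - \<epsilon>) * v) * ((1 + \<epsilon>) * m) \<le> ((1 - \<epsilon>) * v) * max 1 (2 * m1)"
    proof (rule mult_left_mono[OF _ p])
      have "(1 + \<epsilon>) * m \<le> 2 * m1" using \<epsilon> m by (intro mult_mono) auto
      then show "(1 + \<epsilon>) * m \<le> max 1 (2 * m1)" by simp
    qed
    ultimately show ?thesis unfolding fac by (simp add: algebra_simps)
  qed
  have m0: "0 < min 1 m0" using m by simp
  have W: "0 < ?W" using lo mult_pos_pos[OF m0 V] by linarith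
  have "ln (min 1 m0) + ln ?V \<le> ln ?W"
    using ln_mono[OF lo mult_pos_pos[OF m0 V]] ln_mult_pos[OF m0 V] by linarith
  moreover have "ln ?W \<le> ln (max 1 (2 * m1)) + ln ?V"
    using ln_mono[OF hi W] ln_mult_pos[of "max 1 (2 * m1)" ?V] V by simp
  ultimately show ?thesis by linarith
qed

text \<open>
  Positivity of the energy of \<open>cos (x + \<beta>)\<close> on the image of the circle of radius \<open>\<rho>\<close>.  The
  logarithmic singularity on the diagonal is regularised by shrinking the sphere points by the
  factor \<open>\<surd>(1 - \<epsilon>\<^sup>2)\<close>, which gives the kernel \<open>W\<close>.  It is compared with the kernel
  \<open>V = |1 - (1 - \<epsilon>) cis (y - x)|\<^sup>2\<close>, which is comparable to \<open>W\<close> near the diagonal and whose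
  energy is known in closed form.
\<close>
lemma grunsky_circle_inequality:
  assumes h: "h holomorphic_on ball 0 1" "inj_on h (ball 0 1)" "h 0 = 0" "deriv h 0 = 1"
    and P: "P holomorphic_on ball 0 1" "\<And>\<zeta>. \<zeta> \<in> ball 0 1 \<Longrightarrow> \<zeta> \<noteq> 0 \<Longrightarrow> P \<zeta> = 1 / \<zeta> - 1 / h \<zeta>"
    and \<rho>: "0 < \<rho>" "\<rho> < 1"
  shows "\<rho>\<^sup>2 * Re (cis (- 2 * \<beta>) * deriv P 0) \<le> 1"
proof -
  obtain q where q: "continuous_on (ball 0 1 \<times> ball 0 1) (\<lambda>(z, w). q z w)"
    "\<And>z w. z \<in> ball 0 1 \<Longrightarrow> w \<in> ball 0 1 \<Longrightarrow> h z - h w = (z - w) * q z w"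
    "\<And>z. q z z = deriv h z"
    using holomorphic_difference_quotient[OF h(1) open_ball convex_ball] by metis
  define D where "D = cbox (0::real, 0::real) (2 * pi, 2 * pi)"
  define c where "c x = cos (x + \<beta>)" for x
  define e where "e x = complex_of_real \<rho> * cis x" for x
  define a where "a x = 1 + (cmod (h (e x)))\<^sup>2" for x
  define m where "m x y = 2 * \<rho>\<^sup>2 * (cmod (q (e x) (e y)))\<^sup>2 / (a x * a y)" for x y
  define v where "v x y = (cmod (cis x - cis y))\<^sup>2" for x y
  \<comment> \<open>\<open>v \<cdot> m\<close> equals \<open>1 - X \<bullet> Y\<close> for the sphere points of the images of \<open>x\<close> and \<open>y\<close>\<close>
  define W where "W \<epsilon> x y = \<epsilon>\<^sup>2 + (1 - \<epsilon>\<^sup>2) * (v x y * m x y)" for \<epsilon> x y :: real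
  define V where "V \<epsilon> x y = \<epsilon>\<^sup>2 + (1 - \<epsilon>) * v x y" for \<epsilon> x y :: real
  have e: "e x \<in> ball 0 1" "e x \<noteq> 0" for x
    using \<rho> by (auto simp: e_def norm_mult)
  have a: "1 \<le> a x" for x by (simp add: a_def)
  have a0: "0 < a x" for x using a[of x] by linarith
  have v0: "0 \<le> v x y" for x y by (simp add: v_def)
  have qnz: "q (e x) (e y) \<noteq> 0" for x y
  proof (cases "e x = e y")
    case True
    then show ?thesis
      using holomorphic_injective_imp_regular[OF h(1) open_ball h(2) e(1)] q(3) by simp
  next
    case False
    then show ?thesis using q(2)[OF e(1)[of x] e(1)[of y]] inj_onD[OF h(2) _ e(1)[of x] e(1)[of y]] by auto
  qed
  have m0: "0 < m x y" for x y
    using a0 \<rho> qnz by (simp add: m_def)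
  have conth: "continuous_on A h" if "A \<subseteq> ball 0 1" for A
    using holomorphic_on_imp_continuous_on[OF h(1)] continuous_on_subset that by blast
  have conte: "continuous_on A (\<lambda>x. e (f x))" if "continuous_on A f" for A :: "'b::t2_space set" and f
    unfolding e_def by (intro continuous_intros that)
  have conthe: "continuous_on A (\<lambda>x. h (e (f x)))" if "continuous_on A f" for A :: "'b::t2_space set" and f
    by (rule continuous_on_compose2[OF conth[OF order_refl] conte[OF that]]) (use e in auto)
  have conta: "continuous_on A (\<lambda>x. a (f x))" if "continuous_on A f" for A :: "'b::t2_space set" and f
    unfolding a_def by (intro continuous_intros conthe that)
  have contc: "continuous_on A (\<lambda>x. c (f x))" if "continuous_on A f" for A :: "'b::t2_space set" and f
    unfolding c_def by (intro continuous_intros that)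
  have contq: "continuous_on A (\<lambda>p. q (e (fst p)) (e (snd p)))" for A
  proof -
    have "continuous_on A (\<lambda>p. (e (fst p), e (snd p)))"
      by (intro continuous_on_Pair conte continuous_intros)
    from continuous_on_compose2[OF q(1) this] show ?thesis using e by (auto simp: image_subset_iff)
  qed
  have contm: "continuous_on A (\<lambda>p. m (fst p) (snd p))" for A
    unfolding m_def using a0 by (intro continuous_intros conta contq) (auto simp: less_imp_neq[THEN not_sym])
  have contv: "continuous_on A (\<lambda>p. v (fst p) (snd p))" for A
    unfolding v_def by (intro continuous_intros)
  have Vpos: "0 < V \<epsilon> x y" and Wpos: "0 < W \<epsilon> x y" if "0 < \<epsilon>" "\<epsilon> < 1" for \<epsilon> x y
  proof -
    have "\<epsilon>\<^sup>2 \<le> 1" using that by (simp add: power_le_one)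
    then show "0 < V \<epsilon> x y" "0 < W \<epsilon> x y"
      unfolding V_def W_def using that v0[of x y] m0[of x y] by (auto intro!: add_pos_nonneg)
  qed
  have intV: "(\<lambda>p. c (fst p) * c (snd p) * ln (V \<epsilon> (fst p) (snd p))) integrable_on D"
    and intW: "(\<lambda>p. c (fst p) * c (snd p) * ln (W \<epsilon> (fst p) (snd p))) integrable_on D"
    and contV: "continuous_on D (\<lambda>p. c (fst p) * c (snd p) * - ln (V \<epsilon> (fst p) (snd p)))"
    if \<epsilon>: "0 < \<epsilon>" "\<epsilon> < 1" for \<epsilon>
  proof -
    have "continuous_on D (\<lambda>p. V \<epsilon> (fst p) (snd p))" "continuous_on D (\<lambda>p. W \<epsilon> (fst p) (snd p))"
      unfolding V_def W_def by (intro continuous_intros contv contm)+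
    then have 1: "continuous_on D (\<lambda>p. ln (V \<epsilon> (fst p) (snd p)))" "continuous_on D (\<lambda>p. ln (W \<epsilon> (fst p) (snd p)))"
      using Vpos[OF \<epsilon>] Wpos[OF \<epsilon>] by (auto intro!: continuous_on_ln simp: less_imp_neq[THEN not_sym])
    show "(\<lambda>p. c (fst p) * c (snd p) * ln (V \<epsilon> (fst p) (snd p))) integrable_on D"
     "(\<lambda>p. c (fst p) * c (snd p) * ln (W \<epsilon> (fst p) (snd p))) integrable_on D"
     "continuous_on D (\<lambda>p. c (fst p) * c (snd p) * - ln (V \<epsilon> (fst p) (snd p)))"
      unfolding D_def by (intro integrable_continuous continuous_intros contc 1[unfolded D_def])+
  qed
  have energy_W: "0 \<le> integral D (\<lambda>p. c (fst p) * c (snd p) * - ln (W \<epsilon> (fst p) (snd p)))"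
    if \<epsilon>: "0 < \<epsilon>" "\<epsilon> < 1" for \<epsilon>
  proof -
    define X where "X x = sqrt (1 - \<epsilon>\<^sup>2) *\<^sub>R sphere_point (h (e x))" for x
    have e2: "0 \<le> 1 - \<epsilon>\<^sup>2" "1 - \<epsilon>\<^sup>2 < 1" using \<epsilon> by (simp_all add: power_le_one)
    have "1 - X x \<bullet> X y = W \<epsilon> x y" for x y
    proof -
      have "v x y * m x y = 2 * (cmod (h (e x) - h (e y)))\<^sup>2 / (a x * a y)"
      proof -
        have "e x - e y = of_real \<rho> * (cis x - cis y)" by (simp add: e_def algebra_simps)
        then have "(cmod (h (e x) - h (e y)))\<^sup>2 = \<rho>\<^sup>2 * v x y * (cmod (q (e x) (e y)))\<^sup>2"
          using q(2)[OF e(1)[of x] e(1)[of y]] \<rho> by (simp add: v_def norm_mult power_mult_distrib)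
        then show ?thesis by (simp add: m_def)
      qed
      moreover have "X x \<bullet> X y = (1 - \<epsilon>\<^sup>2) * (sphere_point (h (e x)) \<bullet> sphere_point (h (e y)))"
        using e2(1) by (simp add: X_def flip: mult.assoc)
      ultimately show ?thesis
        unfolding sphere_point_inner W_def a_def by (simp add: algebra_simps)
    qed
    moreover have "0 \<le> integral D (\<lambda>(x, y). c x * c y * - ln (1 - X x \<bullet> X y))"
      unfolding D_def
    proof (rule log_kernel_nonneg[where q = "sqrt (1 - \<epsilon>\<^sup>2)"])
      show "continuous_on {0..2 * pi} X" unfolding X_def
        by (intro continuous_intros conthe)
      show "continuous_on {0..2 * pi} c" by (intro contc continuous_intros)
    qed (use e2 in \<open>auto simp: X_def norm_sphere_point\<close>)
    ultimately show ?thesis by (simp add: case_prod_unfold)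
  qed
  have circ_c: "((\<lambda>x. c x * c x) has_integral pi) {0..2 * pi}"
  proof -
    have "deriv (\<lambda>z. cis \<beta> * z) 0 = cis \<beta>"
      by (rule DERIV_imp_deriv) (auto intro!: derivative_eq_intros)
    then show ?thesis
      using circle_integral_cos[of "\<lambda>z. cis \<beta> * z" 2 1 \<beta>]
      by (simp add: c_def cis_mult holomorphic_intros add.commute mult.assoc)
  qed
  have circ_c0: "(c has_integral 0) {0..2 * pi}"
    using circle_integral_cos[of "\<lambda>z. 1" 2 1 \<beta>] by (simp add: c_def[abs_def])
  have energy_V: "integral D (\<lambda>p. c (fst p) * c (snd p) * - ln (V \<epsilon> (fst p) (snd p))) = 2 * pi\<^sup>2 * (1 - \<epsilon>)"
    if \<epsilon>: "0 < \<epsilon>" "\<epsilon> < 1" for \<epsilon>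
  proof -
    have Veq: "V \<epsilon> x y = (cmod (1 - of_real (1 - \<epsilon>) * cis (y - x)))\<^sup>2" for x y
    proof -
      have v_eq: "v x y = 2 - 2 * cos (y - x)"
      proof -
        have "v x y = (cos x)\<^sup>2 + (sin x)\<^sup>2 + ((cos y)\<^sup>2 + (sin y)\<^sup>2) - 2 * (cos y * cos x + sin y * sin x)"
          unfolding v_def cmod_power2 by (simp add: power2_eq_square algebra_simps)
        then show ?thesis by (simp add: cos_diff)
      qed
      have cm: "(cmod (1 - of_real \<tau> * cis u))\<^sup>2 = 1 - 2 * \<tau> * cos u + \<tau>\<^sup>2" for \<tau> u
        by (simp add: cmod_power2 power_mult_distrib sin_squared_eq power2_diff algebra_simps)
      show ?thesis unfolding V_def v_eq cm by (simp add: power2_eq_square algebra_simps)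
    qed
    have "integral {0..2 * pi} (\<lambda>y. c x * c y * - ln (V \<epsilon> x y)) = 2 * pi * (1 - \<epsilon>) * (c x * c x)" for x
    proof -
      have I: "((\<lambda>y. - 2 * c x * (ln (cmod (1 - of_real (1 - \<epsilon>) * cis (y - x))) * cos (y + \<beta>))) has_integral
          - 2 * c x * (- pi * (1 - \<epsilon>) * cos (x + \<beta>))) {0..2 * pi}"
        by (intro has_integral_mult_right log_circle_integral) (use \<epsilon> in auto)
      have E: "- 2 * c x * (ln (cmod (1 - of_real (1 - \<epsilon>) * cis (y - x))) * cos (y + \<beta>)) =
          c x * c y * - ln (V \<epsilon> x y)" for y
        unfolding Veq c_def by (simp add: ln_realpow)
      from integral_unique[OF I[unfolded E]] show ?thesis
        by (simp add: c_def)
    qed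
    moreover have "integral {0..2 * pi} (\<lambda>x. 2 * pi * (1 - \<epsilon>) * (c x * c x)) = 2 * pi\<^sup>2 * (1 - \<epsilon>)"
      using has_integral_mult_right[OF circ_c, of "2 * pi * (1 - \<epsilon>)"]
      by (intro integral_unique) (simp add: power2_eq_square mult_ac)
    ultimately show ?thesis
      using integral_prod_continuous[OF contV[OF \<epsilon>, unfolded D_def]] by (simp add: D_def)
  qed
  obtain m0 m1 where m01: "0 < m0" "\<And>x y. (x, y) \<in> D \<Longrightarrow> m0 \<le> m x y" "\<And>x y. (x, y) \<in> D \<Longrightarrow> m x y \<le> m1"
  proof -
    have D: "compact D" "D \<noteq> {}" unfolding D_def by (rule compact_cbox) (auto simp: cbox_Pair_eq)
    obtain p0 where "p0 \<in> D" "\<And>p. p \<in> D \<Longrightarrow> m (fst p0) (snd p0) \<le> m (fst p) (snd p)"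
      using continuous_attains_inf[OF D contm] by auto
    moreover obtain p1 where "p1 \<in> D" "\<And>p. p \<in> D \<Longrightarrow> m (fst p) (snd p) \<le> m (fst p1) (snd p1)"
      using continuous_attains_sup[OF D contm] by auto
    ultimately show ?thesis using that m0 by (metis fst_conv snd_conv)
  qed
  \<comment> \<open>on the diagonal both kernels equal \<open>\<epsilon>\<^sup>2\<close>, so the limit of their logarithmic ratio is \<open>0\<close> there, not \<open>ln m\<close>\<close>
  define g where "g p = c (fst p) * c (snd p) * (if v (fst p) (snd p) = 0 then 0 else ln (m (fst p) (snd p)))" for p
  define \<epsilon> where "\<epsilon> k = 1 / (real k + 2)" for k
  have \<epsilon>: "0 < \<epsilon> k" "\<epsilon> k < 1" for k by (auto simp: \<epsilon>_def)
  have \<epsilon>_lim: "\<epsilon> \<longlonglongrightarrow> 0"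
    unfolding \<epsilon>_def by real_asymp
  define f where "f k p = c (fst p) * c (snd p) * ln (W (\<epsilon> k) (fst p) (snd p)) -
     c (fst p) * c (snd p) * ln (V (\<epsilon> k) (fst p) (snd p))" for k p
  have lim: "(\<lambda>k. integral D (f k)) \<longlonglongrightarrow> integral D g"
  proof (rule dominated_convergence(2))
    show "f k integrable_on D" for k
      unfolding f_def by (intro integrable_diff intV intW \<epsilon>)
    show "(\<lambda>_. \<bar>ln (min 1 m0)\<bar> + \<bar>ln (max 1 (2 * m1))\<bar>) integrable_on D"
      unfolding D_def by (rule integrable_const)
  next
    fix k p assume p: "p \<in> D"
    obtain x y where xy: "p = (x, y)" by (cases p)
    have "\<bar>c x * c y\<bar> \<le> 1 * 1"
      unfolding abs_mult c_def by (intro mult_mono) auto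
    moreover have "\<bar>ln (W (\<epsilon> k) x y) - ln (V (\<epsilon> k) x y)\<bar> \<le> \<bar>ln (min 1 m0)\<bar> + \<bar>ln (max 1 (2 * m1))\<bar>"
      unfolding W_def V_def using p xy by (intro log_kernel_ratio_bound \<epsilon> v0 m01) auto
    ultimately have "\<bar>c x * c y\<bar> * \<bar>ln (W (\<epsilon> k) x y) - ln (V (\<epsilon> k) x y)\<bar> \<le> 1 * (\<bar>ln (min 1 m0)\<bar> + \<bar>ln (max 1 (2 * m1))\<bar>)"
      by (intro mult_mono) auto
    then show "norm (f k p) \<le> \<bar>ln (min 1 m0)\<bar> + \<bar>ln (max 1 (2 * m1))\<bar>"
      by (simp add: f_def xy flip: right_diff_distrib abs_mult)
  next
    fix p assume p: "p \<in> D"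
    obtain x y where xy: "p = (x, y)" by (cases p)
    show "(\<lambda>k. f k p) \<longlonglongrightarrow> g p"
    proof (cases "v x y = 0")
      case True
      then show ?thesis by (simp add: f_def g_def W_def V_def xy)
    next
      case False
      have "(\<lambda>k. W (\<epsilon> k) x y) \<longlonglongrightarrow> 0\<^sup>2 + (1 - 0\<^sup>2) * (v x y * m x y)"
        "(\<lambda>k. V (\<epsilon> k) x y) \<longlonglongrightarrow> 0\<^sup>2 + (1 - 0) * v x y"
        unfolding W_def V_def by (intro tendsto_intros \<epsilon>_lim)+
      then have "(\<lambda>k. f k p) \<longlonglongrightarrow> c x * c y * ln (v x y * m x y) - c x * c y * ln (v x y)"
        unfolding f_def xy fst_conv snd_conv using False m0[of x y]
        by (intro tendsto_intros) auto
      also have "c x * c y * ln (v x y * m x y) - c x * c y * ln (v x y) = g p"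
        using False m0[of x y] by (simp add: g_def xy ln_mult algebra_simps)
      finally show ?thesis .
    qed
  qed
  have "integral D (f k) \<le> 2 * pi\<^sup>2" for k
  proof -
    have "integral D (f k) = integral D (\<lambda>p. c (fst p) * c (snd p) * - ln (V (\<epsilon> k) (fst p) (snd p)))
        - integral D (\<lambda>p. c (fst p) * c (snd p) * - ln (W (\<epsilon> k) (fst p) (snd p)))"
      unfolding f_def using intV[OF \<epsilon>[of k]] intW[OF \<epsilon>[of k]] by (simp add: integral_diff)
    also have "\<dots> \<le> 2 * pi\<^sup>2 * (1 - \<epsilon> k)" using energy_V[OF \<epsilon>[of k]] energy_W[OF \<epsilon>[of k]] by simp
    also have "\<dots> \<le> 2 * pi\<^sup>2" using \<epsilon>[of k] by (simp add: mult_le_cancel_left1)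
    finally show ?thesis .
  qed
  then have g_le: "integral D g \<le> 2 * pi\<^sup>2"
    using LIMSEQ_le_const2[OF lim] by blast
  have "integral D g = integral D (\<lambda>p. c (fst p) * c (snd p) * ln (m (fst p) (snd p)))"
  proof (rule integral_spike[OF negligible_cis_diagonal])
    fix p assume "p \<in> D - {p \<in> cbox (0, 0) (2 * pi, 2 * pi). cis (fst p) = cis (snd p)}"
    then show "c (fst p) * c (snd p) * ln (m (fst p) (snd p)) = g p"
      by (auto simp: g_def v_def D_def)
  qed
  also have "\<dots> = integral {0..2 * pi} (\<lambda>x. integral {0..2 * pi} (\<lambda>y. c x * c y * ln (m x y)))"
  proof -
    have "continuous_on D (\<lambda>p. c (fst p) * c (snd p) * ln (m (fst p) (snd p)))"
      by (intro continuous_intros contc contm) (use m0 in \<open>auto simp: less_imp_neq[THEN not_sym]\<close>)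
    then show ?thesis
      using integral_prod_continuous[of 0 0 "2 * pi" "2 * pi" "\<lambda>p. c (fst p) * c (snd p) * ln (m (fst p) (snd p))"]
      by (simp add: D_def)
  qed
  also have "\<dots> = 2 * pi\<^sup>2 * (\<rho>\<^sup>2 * Re (cis (- 2 * \<beta>) * deriv P 0))"
  proof -
    define K where "K = complex_of_real (pi * \<rho>) * cis (- \<beta>)"
    define C where "C = integral {0..2 * pi} (\<lambda>y. c y * ln (a y))"
    have C: "((\<lambda>y. c y * ln (a y)) has_integral C) {0..2 * pi}"
      unfolding C_def by (intro integrable_integral integrable_continuous_interval continuous_intros contc conta)
        (use a0 in \<open>auto simp: less_imp_neq[THEN not_sym]\<close>)
    \<comment> \<open>\<open>ln m\<close> splits into terms in one variable and \<open>2 ln |q|\<close>; the terms depending on \<open>x\<close> only integrate to \<open>0\<close>\<close>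
    have inner: "integral {0..2 * pi} (\<lambda>y. c x * c y * ln (m x y)) = 2 * (Re (K * P (e x)) * c x) - C * c x" for x
    proof -
      have I: "((\<lambda>y. c x * ((ln (2 * \<rho>\<^sup>2) - ln (a x)) * c y - c y * ln (a y) + 
           2 * (ln (cmod (q (of_real \<rho> * cis y) (e x))) * cos (y + \<beta>)))) has_integral
           c x * ((ln (2 * \<rho>\<^sup>2) - ln (a x)) * 0 - C + 2 * Re (K * (1 / e x - 1 / h (e x))))) {0..2 * pi}"
        unfolding K_def
        by (intro has_integral_mult_right has_integral_add has_integral_diff circ_c0 C
            log_quotient_circle_integral[OF h q(2,3) e \<rho>])
      have E: "c x * ((ln (2 * \<rho>\<^sup>2) - ln (a x)) * c y - c y * ln (a y) + 
           2 * (ln (cmod (q (of_real \<rho> * cis y) (e x))) * cos (y + \<beta>))) = c x * c y * ln (m x y)" for y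
      proof -
        have sym: "cmod (q (e x) (e y)) = cmod (q (e y) (e x))"
        proof (cases "e x = e y")
          case False
          then have "q (e x) (e y) = (h (e x) - h (e y)) / (e x - e y)"
            "q (e y) (e x) = (h (e y) - h (e x)) / (e y - e x)"
            using q(2)[OF e(1)[of x] e(1)[of y]] q(2)[OF e(1)[of y] e(1)[of x]] by simp_all
          then show ?thesis by (simp add: norm_divide norm_minus_commute)
        qed simp
        have lnm: "ln (m x y) = ln (2 * \<rho>\<^sup>2) + 2 * ln (cmod (q (e y) (e x))) - (ln (a x) + ln (a y))"
          unfolding m_def sym using a0[of x] a0[of y] \<rho> qnz[of y x] by (simp add: ln_div ln_mult ln_realpow)
        show ?thesis unfolding lnm c_def e_def by (simp add: algebra_simps)
      qed
      from integral_unique[OF I[unfolded E]] show ?thesis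
        by (simp add: P(2)[OF e] algebra_simps)
    qed
    have "(\<lambda>z. K * P z) holomorphic_on ball 0 1" by (intro holomorphic_intros P)
    from circle_integral_cos[OF this \<rho>, of \<beta>]
    have "((\<lambda>x. Re (K * P (e x)) * c x) has_integral Re (K * deriv (\<lambda>z. K * P z) 0)) {0..2 * pi}"
      by (simp add: K_def e_def c_def)
    from has_integral_diff[OF has_integral_mult_right[OF this, of 2] has_integral_mult_right[OF circ_c0, of C]]
    have "integral {0..2 * pi} (\<lambda>x. 2 * (Re (K * P (e x)) * c x) - C * c x) = 2 * Re (K * deriv (\<lambda>z. K * P z) 0)"
      by (intro integral_unique) simp
    moreover have "deriv (\<lambda>z. K * P z) 0 = K * deriv P 0"
      using holomorphic_on_imp_differentiable_at[OF P(1) open_ball, of 0] by simp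
    moreover have "K * K = complex_of_real (pi\<^sup>2 * \<rho>\<^sup>2) * cis (- 2 * \<beta>)"
      by (simp add: K_def power2_eq_square cis_mult mult_ac)
    then have "K * (K * deriv P 0) = complex_of_real (pi\<^sup>2 * \<rho>\<^sup>2) * (cis (- 2 * \<beta>) * deriv P 0)"
      by (simp flip: mult.assoc)
    ultimately show ?thesis unfolding inner by (simp only: Re_complex_of_real mult.assoc) simp
  qed
  finally have "2 * pi\<^sup>2 * (\<rho>\<^sup>2 * Re (cis (- 2 * \<beta>) * deriv P 0)) \<le> 2 * pi\<^sup>2 * 1"
    using g_le by simp
  then show ?thesis by (subst (asm) mult_le_cancel_left_pos) auto
qed

text \<open>
  The number \<open>P' 0\<close> is the coefficient of \<open>z \<zeta>\<close> in \<open>log ((h z - h \<zeta>)/(z - \<zeta>))\<close>; for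
  \<open>h z = z + a\<^sub>2 z\<^sup>2 + a\<^sub>3 z\<^sup>3 + ...\<close> it is \<open>a\<^sub>3 - a\<^sub>2\<^sup>2\<close>.  The angle \<open>\<beta>\<close> is chosen to
  rotate it onto the positive axis, and \<open>\<rho>\<close> tends to \<open>1\<close>.
\<close>
lemma grunsky_first_coefficient:
  assumes h: "h holomorphic_on ball 0 1" "inj_on h (ball 0 1)" "h 0 = 0" "deriv h 0 = 1"
    and P: "P holomorphic_on ball 0 1" "\<And>\<zeta>. \<zeta> \<in> ball 0 1 \<Longrightarrow> \<zeta> \<noteq> 0 \<Longrightarrow> P \<zeta> = 1 / \<zeta> - 1 / h \<zeta>"
  shows "cmod (deriv P 0) \<le> 1"
proof (rule field_le_mult_one_interval)
  fix s :: real assume s: "0 < s" "s < 1"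
  define \<beta> where "\<beta> = Arg (deriv P 0) / 2"
  have "cis (- 2 * \<beta>) * deriv P 0 = cis (- 2 * \<beta>) * rcis (cmod (deriv P 0)) (Arg (deriv P 0))"
    by (simp add: rcis_cmod_Arg)
  also have "\<dots> = of_real (cmod (deriv P 0))"
    by (simp add: \<beta>_def rcis_def cis_mult)
  finally have e: "cis (- 2 * \<beta>) * deriv P 0 = of_real (cmod (deriv P 0))" .
  show "s * cmod (deriv P 0) \<le> 1"
    using grunsky_circle_inequality[OF h P, of "sqrt s" \<beta>] s unfolding e by simp
qed

section \<open>Bieberbach's inequality and the convexity bound for univalent functions\<close>

text \<open>
  This is \<open>|a\<^sub>2| \<le> 2\<close>, since the second derivative at \<open>0\<close> is \<open>2 a\<^sub>2\<close>.  The square root transform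
  \<open>h z = z M(z\<^sup>2)\<close>, where \<open>M\<^sup>2 = g z / z\<close>, satisfies \<open>h(z)\<^sup>2 = g(z\<^sup>2)\<close>; being odd, it inherits
  injectivity from \<open>g\<close>, and its third coefficient is \<open>M' 0 = a\<^sub>2/2\<close>.
\<close>
theorem bieberbach_second_coefficient:
  assumes g: "g holomorphic_on ball 0 1" "inj_on g (ball 0 1)" "g 0 = 0" "deriv g 0 = 1"
  shows "cmod (deriv (deriv g) 0) \<le> 4"
proof -
  define k where "k z = (if z = 0 then deriv g 0 else (g z - g 0) / (z - 0))" for z
  have k: "k holomorphic_on ball 0 1"
    unfolding k_def by (rule pole_lemma_open[OF g(1) open_ball])
  have gk: "g z = z * k z" for z by (simp add: k_def g)
  have knz: "k z \<noteq> 0" if "z \<in> ball 0 1" for z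
    using inj_onD[OF g(2) _ that, of 0] g(3,4) by (auto simp: k_def)
  obtain m where m: "m holomorphic_on ball 0 1" "\<And>z. z \<in> ball 0 1 \<Longrightarrow> k z = m z ^ 2"
    using contractible_imp_holomorphic_sqrt[OF k convex_imp_contractible[OF convex_ball] knz] by metis
  have m0: "(m 0)\<^sup>2 = 1" using m(2)[of 0] g(4) by (simp add: k_def)
  define M where "M z = m z / m 0" for z
  have M: "M holomorphic_on ball 0 1" "M 0 = 1"
  proof -
    have "m 0 \<noteq> 0" using m0 by auto
    then show "M holomorphic_on ball 0 1" "M 0 = 1"
      using m(1) by (auto simp: M_def[abs_def] intro!: holomorphic_intros)
  qed
  have kM: "k z = M z ^ 2" if "z \<in> ball 0 1" for z
    using m(2)[OF that] m0 by (simp add: M_def power_divide)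
  have Mnz: "M z \<noteq> 0" if "z \<in> ball 0 1" for z
    using knz[OF that] kM[OF that] by auto
  have sq: "z\<^sup>2 \<in> ball 0 1" if "z \<in> ball 0 (1::real)" for z :: complex
    using that by (simp add: norm_power power_less_one_iff)
  have sq': "(\<lambda>z. F (z\<^sup>2)) holomorphic_on ball 0 1" if "F holomorphic_on ball 0 1" for F :: "complex \<Rightarrow> complex"
    by (rule holomorphic_on_compose_gen[OF _ that, of "\<lambda>z. z\<^sup>2", unfolded o_def])
       (use sq in \<open>auto intro!: holomorphic_intros\<close>)
  have dsq: "((\<lambda>z. z * F (z\<^sup>2)) has_field_derivative F 0) (at 0)" if "F holomorphic_on ball 0 1" for F :: "complex \<Rightarrow> complex"
  proof -
    have "((\<lambda>z. F (z\<^sup>2)) has_field_derivative deriv (\<lambda>z. F (z\<^sup>2)) 0) (at 0)"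
      using holomorphic_derivI[OF sq'[OF that] open_ball, of 0] by simp
    from DERIV_mult[OF DERIV_ident this] show ?thesis by simp
  qed
  define h where "h z = z * M (z\<^sup>2)" for z
  have hsq: "(h z)\<^sup>2 = g (z\<^sup>2)" if "z \<in> ball 0 1" for z
    using kM[OF sq[OF that]] by (simp add: h_def gk power_mult_distrib)
  have h: "h holomorphic_on ball 0 1" "h 0 = 0" "deriv h 0 = 1"
    unfolding h_def using sq'[OF M(1)] DERIV_imp_deriv[OF dsq[OF M(1)]] M(2)
    by (auto intro!: holomorphic_intros)
  have "inj_on h (ball 0 1)"
  proof (rule inj_onI)
    fix z w assume zw: "z \<in> ball 0 1" "w \<in> ball 0 1" "h z = h w"
    then have "z\<^sup>2 = w\<^sup>2"
      using hsq inj_onD[OF g(2) _ sq sq] by metis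
    then consider "z = w" | "z = - w" by (metis power2_eq_iff)
    then show "z = w"
    proof cases
      case 2
      then have "h w = 0" using zw(3) by (simp add: h_def)
      then have "w = 0" using Mnz[OF sq[OF zw(2)]] by (simp add: h_def)
      with 2 show ?thesis by simp
    qed
  qed
  define R where "R y = 1 - 1 / M y" for y
  have R: "R holomorphic_on ball 0 1" "R 0 = 0"
    unfolding R_def using M Mnz by (auto intro!: holomorphic_intros)
  define N where "N y = (if y = 0 then deriv R 0 else (R y - R 0) / (y - 0))" for y
  have N: "N holomorphic_on ball 0 1"
    unfolding N_def by (rule pole_lemma_open[OF R(1) open_ball])
  define P where "P z = z * N (z\<^sup>2)" for z
  have "cmod (deriv P 0) \<le> 1"
  proof (rule grunsky_first_coefficient[OF h(1) \<open>inj_on h (ball 0 1)\<close> h(2,3)])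
    show "P holomorphic_on ball 0 1"
      unfolding P_def by (intro holomorphic_intros sq' N)
    show "P \<zeta> = 1 / \<zeta> - 1 / h \<zeta>" if "\<zeta> \<in> ball 0 1" "\<zeta> \<noteq> 0" for \<zeta>
      using that Mnz[OF sq[OF that(1)]] R(2)
      by (simp add: P_def N_def R_def h_def M(2) field_simps power2_eq_square)
  qed
  moreover have "deriv P 0 = deriv R 0"
    using DERIV_imp_deriv[OF dsq[OF N]] by (simp add: P_def[abs_def] N_def)
  moreover have dM: "(M has_field_derivative deriv M 0) (at 0)"
    using holomorphic_derivI[OF M(1) open_ball, of 0] by simp
  have "(R has_field_derivative deriv M 0) (at 0)"
    unfolding R_def by (rule derivative_eq_intros dM refl | simp add: M(2))+
  then have "deriv R 0 = deriv M 0" by (rule DERIV_imp_deriv)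
  moreover have "deriv (deriv g) 0 = 4 * deriv M 0"
  proof -
    have "((\<lambda>z. M z ^ 2) has_field_derivative 2 * deriv M 0) (at 0)"
      by (rule derivative_eq_intros dM refl | simp add: M(2))+
    then have dk: "(k has_field_derivative 2 * deriv M 0) (at 0)"
      by (rule has_field_derivative_transform_within_open[OF _ open_ball, of _ _ _ 0 1]) (use kM in auto)
    have dg: "deriv g z = k z + z * deriv k z" if "z \<in> ball 0 1" for z
    proof -
      have "((\<lambda>z. z * k z) has_field_derivative 1 * k z + deriv k z * z) (at z)"
        by (intro DERIV_mult DERIV_ident holomorphic_derivI[OF k open_ball that])
      then show ?thesis
        using DERIV_imp_deriv gk[abs_def] by (metis mult.commute mult_1)
    qed
    have dk': "deriv k field_differentiable at 0"
      using holomorphic_on_imp_differentiable_at[OF holomorphic_deriv[OF k open_ball] open_ball, of 0] by simp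
    have "((\<lambda>z. k z + z * deriv k z) has_field_derivative 2 * deriv M 0 + (1 * deriv k 0 + deriv (deriv k) 0 * 0)) (at 0)"
      by (intro DERIV_add dk DERIV_mult DERIV_ident) (use dk' in \<open>simp add: DERIV_deriv_iff_field_differentiable\<close>)
    then have "(deriv g has_field_derivative 2 * deriv M 0 + (1 * deriv k 0 + deriv (deriv k) 0 * 0)) (at 0)"
      by (rule has_field_derivative_transform_within_open[OF _ open_ball, of _ _ _ 0 1]) (use dg in auto)
    then show ?thesis using DERIV_imp_deriv[OF dk] by (simp add: DERIV_imp_deriv)
  qed
  ultimately show ?thesis by (simp add: norm_mult)
qed

text \<open>
  The Koebe transform: \<open>g\<close> composed with the disk automorphism \<open>T\<close> taking \<open>0\<close> to \<open>a\<close>, normalised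
  at \<open>0\<close>, is again univalent, and the number estimated here is its second derivative at \<open>0\<close>.
\<close>
lemma univalent_pre_schwarzian_bound:
  fixes a :: complex
  assumes g: "g holomorphic_on ball 0 1" "inj_on g (ball 0 1)" and a: "a \<in> ball 0 1"
  shows "cmod ((1 - (cmod a)\<^sup>2) * (deriv (deriv g) a / deriv g a) - 2 * cnj a) \<le> 4"
proof -
  define T where "T = Moebius_function 0 (- a)"
  define d where "d = deriv g a"
  define s where "s = complex_of_real (1 - (cmod a)\<^sup>2)"
  have na: "cmod a < 1" using a by simp
  have "(cmod a)\<^sup>2 < 1" using na abs_square_less_1[of "cmod a"] by simp
  then have s: "s \<noteq> 0" by (simp add: s_def del: of_real_diff)
  have s_eq: "s = 1 - a * cnj a" by (simp add: s_def complex_norm_square del: of_real_power)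
  have d: "d \<noteq> 0"
    unfolding d_def by (rule holomorphic_injective_imp_regular[OF g(1) open_ball g(2) a])
  have T: "T z = (z + a) / (1 + cnj a * z)" for z
    by (simp add: T_def Moebius_function_simple)
  have T0: "T 0 = a" by (simp add: T)
  have Tball: "T z \<in> ball 0 1" if "z \<in> ball 0 1" for z
    using Moebius_function_norm_lt_1[of "- a" z 0] na that by (simp add: T_def)
  have injT: "inj_on T (ball 0 1)"
    by (rule inj_on_inverseI[of _ "Moebius_function 0 a"])
       (use Moebius_function_compose[of a "- a"] na in \<open>auto simp: T_def\<close>)
  have den: "1 + cnj a * z \<noteq> 0" if "z \<in> ball 0 1" for z
  proof
    assume "1 + cnj a * z = 0"
    then have "cmod (cnj a * z) = 1" by (metis add_eq_0_iff norm_minus_cancel norm_one)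
    moreover have "cmod (cnj a * z) < 1"
      using norm_mult_less[of "cnj a" 1 z 1] na that by simp
    ultimately show False by simp
  qed
  have dT: "(T has_field_derivative s / (1 + cnj a * z)\<^sup>2) (at z)" if "z \<in> ball 0 1" for z
  proof -
    have "((\<lambda>z. (z + a) / (1 + cnj a * z)) has_field_derivative
      (1 * (1 + cnj a * z) - (z + a) * cnj a) / ((1 + cnj a * z) * (1 + cnj a * z))) (at z)"
      by (rule derivative_eq_intros refl | use den[OF that] in simp)+
    then show ?thesis
      by (simp add: T[abs_def] s_eq power2_eq_square algebra_simps)
  qed
  define G where "G z = (g (T z) - g a) / (s * d)" for z
  have dG: "(G has_field_derivative deriv g (T z) / d / (1 + cnj a * z)\<^sup>2) (at z)" if z: "z \<in> ball 0 1" for z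
  proof -
    have "((\<lambda>z. g (T z)) has_field_derivative deriv g (T z) * (s / (1 + cnj a * z)\<^sup>2)) (at z)"
      using DERIV_chain2[OF holomorphic_derivI[OF g(1) open_ball Tball[OF z]] dT[OF z]] .
    from DERIV_cdivide[OF DERIV_diff[OF this DERIV_const], of "g a" "s * d"]
    show ?thesis unfolding G_def using s d by (simp add: field_simps)
  qed
  have "cmod (deriv (deriv G) 0) \<le> 4"
  proof (rule bieberbach_second_coefficient)
    show "G holomorphic_on ball 0 1"
      using dG by (meson holomorphic_on_open open_ball)
    show "inj_on G (ball 0 1)"
    proof (rule inj_onI)
      fix z w assume zw: "z \<in> ball 0 1" "w \<in> ball 0 1" "G z = G w"
      then have "g (T z) = g (T w)" using s d by (simp add: G_def)
      then show "z = w"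
        using inj_onD[OF g(2) _ Tball Tball] inj_onD[OF injT] zw by blast
    qed
    show "G 0 = 0" by (simp add: G_def T0)
    show "deriv G 0 = 1" using DERIV_imp_deriv[OF dG, of 0] d by (simp add: T0 d_def)
  qed
  moreover have "deriv (deriv G) 0 = s * (deriv (deriv g) a / d) - 2 * cnj a"
  proof -
    have "(deriv g has_field_derivative deriv (deriv g) (T 0)) (at (T 0))"
      using holomorphic_derivI[OF holomorphic_deriv[OF g(1) open_ball] open_ball a] T0 by simp
    from DERIV_chain2[OF this dT]
    have 1: "((\<lambda>z. deriv g (T z)) has_field_derivative deriv (deriv g) a * s) (at 0)" by (simp add: T0)
    have "((\<lambda>z. deriv g (T z) / d / (1 + cnj a * z)\<^sup>2) has_field_derivative
        s * (deriv (deriv g) a / d) - 2 * cnj a) (at 0)"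
      by (rule derivative_eq_intros 1 refl | use d in \<open>simp add: T0 d_def field_simps power2_eq_square\<close>)+
    then have "(deriv G has_field_derivative s * (deriv (deriv g) a / d) - 2 * cnj a) (at 0)"
      by (rule has_field_derivative_transform_within_open[OF _ open_ball, of _ _ _ 0 1])
         (use DERIV_imp_deriv[OF dG] in auto)
    then show ?thesis by (rule DERIV_imp_deriv)
  qed
  ultimately show ?thesis by (simp add: s_def d_def)
qed

text \<open>
  Multiplied by \<open>z\<close>, the preceding bound confines \<open>z g''/g'\<close> to a disk with centre on the real
  axis; the left-hand side belongs to the leftmost point of that disk.
\<close>
lemma univalent_convexity_bound:
  fixes z :: complex
  assumes g: "g holomorphic_on ball 0 1" "inj_on g (ball 0 1)" and z: "z \<in> ball 0 1"
  shows "((cmod z)\<^sup>2 - 4 * cmod z + 1) / (1 - (cmod z)\<^sup>2) \<le> Re (1 + z * deriv (deriv g) z / deriv g z)"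
proof -
  define r where "r = cmod z"
  define u where "u = z * deriv (deriv g) z / deriv g z"
  have r: "0 \<le> r" "r < 1" using z by (auto simp: r_def)
  have r2: "0 < 1 - r\<^sup>2" using r by (simp add: power_less_one_iff)
  have "(1 - r\<^sup>2) * u - 2 * r\<^sup>2 = z * ((1 - r\<^sup>2) * (deriv (deriv g) z / deriv g z) - 2 * cnj z)"
    unfolding u_def r_def times_divide_eq_right[symmetric]
    by (simp add: algebra_simps complex_norm_square del: times_divide_eq_right of_real_power)
  then have "cmod ((1 - r\<^sup>2) * u - 2 * r\<^sup>2) = r * cmod ((1 - r\<^sup>2) * (deriv (deriv g) z / deriv g z) - 2 * cnj z)"
    by (simp only: norm_mult r_def)
  also have "\<dots> \<le> r * 4"
    using univalent_pre_schwarzian_bound[OF g z] r by (intro mult_left_mono) (simp_all add: r_def)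
  finally have "- (r * 4) \<le> Re (of_real (1 - r\<^sup>2) * u - of_real (2 * r\<^sup>2))"
    using abs_Re_le_cmod[of "(1 - r\<^sup>2) * u - 2 * r\<^sup>2"] by simp
  then have "r\<^sup>2 - 4 * r + 1 \<le> (1 + Re u) * (1 - r\<^sup>2)"
    by (simp add: algebra_simps del: of_real_diff of_real_mult)
  then show ?thesis
    using r2 by (simp add: pos_divide_le_eq flip: r_def u_def)
qed

section \<open>Schwarz-Pick estimates\<close>

text \<open>
  Schwarz's lemma for \<open>\<phi>\<close> between the disk automorphisms that move \<open>z\<close> and \<open>\<phi> z\<close> to the centre.
  If \<open>\<phi>\<close> reaches the unit circle it is constant and both sides vanish.
\<close>
lemma schwarz_pick_deriv:
  assumes \<phi>: "\<phi> holomorphic_on ball 0 1" "\<And>z. z \<in> ball 0 1 \<Longrightarrow> cmod (\<phi> z) \<le> 1" and z: "z \<in> ball 0 1"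
  shows "cmod (deriv \<phi> z) * (1 - (cmod z)\<^sup>2) \<le> 1 - (cmod (\<phi> z))\<^sup>2"
proof (cases "\<exists>\<xi>\<in>ball 0 1. cmod (\<phi> \<xi>) = 1")
  case True
  then obtain \<xi> where \<xi>: "\<xi> \<in> ball 0 1" "cmod (\<phi> \<xi>) = 1" by blast
  have "\<phi> constant_on ball 0 1"
    by (rule maximum_modulus_principle[OF \<phi>(1) open_ball connected_ball open_ball order_refl \<xi>(1)])
       (use \<phi>(2) \<xi>(2) in simp)
  then obtain k where k: "\<And>y. y \<in> ball 0 1 \<Longrightarrow> \<phi> y = k" by (auto simp: constant_on_def)
  have "(\<phi> has_field_derivative 0) (at z)"
    by (rule has_field_derivative_transform_within_open[OF DERIV_const open_ball z]) (use k in simp)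
  then show ?thesis using k[OF z] k[OF \<xi>(1)] \<xi>(2) by (simp add: DERIV_imp_deriv)
next
  case False
  have lt: "cmod (\<phi> y) < 1" if "y \<in> ball 0 1" for y
    using \<phi>(2)[OF that] False that by (metis order_le_less)
  define b where "b = \<phi> z"
  have nb: "cmod b < 1" and nz: "cmod z < 1" using lt[OF z] z by (auto simp: b_def)
  have sq: "(cmod b)\<^sup>2 < 1" "(cmod z)\<^sup>2 < 1"
    using nb nz abs_square_less_1[of "cmod b"] abs_square_less_1[of "cmod z"] by auto
  define S where "S = Moebius_function 0 b"
  define T where "T = Moebius_function 0 (- z)"
  have T: "T y = (y + z) / (1 + cnj z * y)" for y by (simp add: T_def Moebius_function_simple)
  have S: "S y = (y - b) / (1 - cnj b * y)" for y by (simp add: S_def Moebius_function_simple)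
  have T0: "T 0 = z" by (simp add: T)
  have Tball: "T y \<in> ball 0 1" if "y \<in> ball 0 1" for y
    using Moebius_function_norm_lt_1[of "- z" y 0] nz that by (simp add: T_def)
  have holT: "T holomorphic_on ball 0 1"
    unfolding T_def by (rule Moebius_function_holomorphic) (use nz in simp)
  have holS: "S holomorphic_on ball 0 1"
    unfolding S_def by (rule Moebius_function_holomorphic[OF nb])
  have hol1: "(\<phi> \<circ> T) holomorphic_on ball 0 1"
    by (rule holomorphic_on_compose_gen[OF holT \<phi>(1)]) (use Tball in auto)
  have hol: "(S \<circ> (\<phi> \<circ> T)) holomorphic_on ball 0 1"
    by (rule holomorphic_on_compose_gen[OF hol1 holS]) (use Tball lt in auto)
  have "cmod (deriv (S \<circ> (\<phi> \<circ> T)) 0) \<le> 1"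
  proof (rule Schwarz_Lemma(2)[OF hol, of 0])
    show "(S \<circ> (\<phi> \<circ> T)) 0 = 0" by (simp add: T0 S b_def)
    show "cmod ((S \<circ> (\<phi> \<circ> T)) y) < 1" if "cmod y < 1" for y
      unfolding o_def S_def
      by (rule Moebius_function_norm_lt_1[OF nb lt[OF Tball]]) (use that in simp)
  qed simp
  moreover have "deriv (S \<circ> (\<phi> \<circ> T)) 0 = deriv \<phi> z * of_real ((1 - (cmod z)\<^sup>2) / (1 - (cmod b)\<^sup>2))"
  proof -
    have e: "b * cnj b = of_real ((cmod b)\<^sup>2)" "z * cnj z = of_real ((cmod z)\<^sup>2)"
      by (simp_all only: complex_norm_square)
    have bb: "1 - cnj b * b \<noteq> 0"
    proof
      assume "1 - cnj b * b = 0"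
      then have "complex_of_real ((cmod b)\<^sup>2) = of_real 1" using e by (simp add: mult.commute)
      then show False using sq(1) by (simp only: of_real_eq_iff)
    qed
    have "((\<lambda>y. (y + z) / (1 + cnj z * y)) has_field_derivative
        (1 * (1 + cnj z * 0) - (0 + z) * cnj z) / ((1 + cnj z * 0) * (1 + cnj z * 0))) (at 0)"
      by (rule derivative_eq_intros refl | simp)+
    then have dT: "(T has_field_derivative 1 - z * cnj z) (at 0)" by (simp add: T[abs_def])
    have "((\<lambda>y. (y - b) / (1 - cnj b * y)) has_field_derivative
        (1 * (1 - cnj b * b) - (b - b) * (- cnj b)) / ((1 - cnj b * b) * (1 - cnj b * b))) (at b)"
      by (rule derivative_eq_intros refl | use bb in simp)+
    then have dS: "(S has_field_derivative 1 / (1 - cnj b * b)) (at (\<phi> (T 0)))"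
      using bb by (simp add: S[abs_def] T0 b_def)
    have "(\<phi> has_field_derivative deriv \<phi> z) (at (T 0))"
      unfolding T0 by (rule holomorphic_derivI[OF \<phi>(1) open_ball z])
    from DERIV_chain[OF dS[folded o_def[of \<phi> T, THEN fun_cong]] DERIV_chain[OF this dT]]
    have "deriv (S \<circ> (\<phi> \<circ> T)) 0 = 1 / (1 - cnj b * b) * (deriv \<phi> z * (1 - z * cnj z))"
      by (rule DERIV_imp_deriv)
    then show ?thesis unfolding mult.commute[of "cnj b" b] e by simp
  qed
  ultimately have "cmod (deriv \<phi> z) * ((1 - (cmod z)\<^sup>2) / (1 - (cmod b)\<^sup>2)) \<le> 1"
    using sq by (simp add: norm_mult norm_divide del: of_real_divide of_real_diff)
  then show ?thesis using sq by (simp add: b_def field_simps)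
qed

text \<open>
  With \<open>w z = z \<phi>(z)\<close> one has \<open>z w' - w = z\<^sup>2 \<phi>'\<close>, and \<open>schwarz_pick_deriv\<close> applies to \<open>\<phi>\<close>.
\<close>
lemma schwarz_function_deriv:
  assumes w: "w holomorphic_on ball 0 1" "w 0 = 0" "\<And>z. z \<in> ball 0 1 \<Longrightarrow> cmod (w z) \<le> 1"
    and z: "z \<in> ball 0 1"
  shows "cmod (w z) \<le> cmod z"
    and "cmod (z * deriv w z - w z) * (1 - (cmod z)\<^sup>2) \<le> (cmod z)\<^sup>2 - (cmod (w z))\<^sup>2"
proof -
  have lt: "cmod (w y) < 1" if "cmod y < 1" for y
  proof (rule ccontr)
    assume "\<not> cmod (w y) < 1"
    then have "cmod (w v) \<le> cmod (w y)" if "v \<in> ball 0 1" for v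
      using w(3)[OF that] by linarith
    then have "w constant_on ball 0 1"
      by (intro maximum_modulus_principle[OF w(1) open_ball connected_ball open_ball order_refl, of y])
         (use that in auto)
    then have "w y = w 0" using that by (auto simp: constant_on_def)
    then show False using \<open>\<not> cmod (w y) < 1\<close> w(2) by simp
  qed
  note schwarz = Schwarz_Lemma[OF w(1,2) lt]
  show "cmod (w z) \<le> cmod z" using schwarz(1)[of z] z by simp
  define \<phi> where "\<phi> y = (if y = 0 then deriv w 0 else (w y - w 0) / (y - 0))" for y
  have \<phi>: "\<phi> holomorphic_on ball 0 1"
    unfolding \<phi>_def by (rule pole_lemma_open[OF w(1) open_ball])
  have w\<phi>: "w y = y * \<phi> y" for y by (simp add: \<phi>_def w)
  have le: "cmod (\<phi> y) \<le> 1" if "y \<in> ball 0 1" for y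
  proof (cases "y = 0")
    case True
    then show ?thesis using schwarz(2)[of 0] by (simp add: \<phi>_def)
  next
    case False
    then show ?thesis using schwarz(1)[of y] that by (simp add: \<phi>_def w(2) norm_divide)
  qed
  have "((\<lambda>y. y * \<phi> y) has_field_derivative 1 * \<phi> z + deriv \<phi> z * z) (at z)"
    by (intro DERIV_mult DERIV_ident holomorphic_derivI[OF \<phi> open_ball z])
  then have "deriv w z = \<phi> z + deriv \<phi> z * z"
    by (simp add: w\<phi>[abs_def] DERIV_imp_deriv)
  then have "z * deriv w z - w z = z\<^sup>2 * deriv \<phi> z"
    by (simp add: w\<phi>[of z] algebra_simps power2_eq_square)
  then have "cmod (z * deriv w z - w z) * (1 - (cmod z)\<^sup>2) = (cmod z)\<^sup>2 * (cmod (deriv \<phi> z) * (1 - (cmod z)\<^sup>2))"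
    by (simp add: norm_mult norm_power)
  also have "\<dots> \<le> (cmod z)\<^sup>2 * (1 - (cmod (\<phi> z))\<^sup>2)"
    by (intro mult_left_mono schwarz_pick_deriv[OF \<phi> le z]) auto
  also have "\<dots> = (cmod z)\<^sup>2 - (cmod (w z))\<^sup>2"
    by (simp add: w\<phi>[of z] norm_mult power_mult_distrib algebra_simps)
  finally show "cmod (z * deriv w z - w z) * (1 - (cmod z)\<^sup>2) \<le> (cmod z)\<^sup>2 - (cmod (w z))\<^sup>2" .
qed

section \<open>The logarithmic derivative in the Janowski class\<close>

text \<open>
  A rational substitute for \<open>r \<le> 2 - \<surd>3\<close>.
\<close>
lemma koebe_convexity_polynomial_bound:
  fixes r :: real
  assumes "r < 1" "0 \<le> r\<^sup>2 - 4 * r + 1"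
  shows "r \<le> 3 / 10"
proof (rule ccontr)
  assume "\<not> r \<le> 3 / 10"
  then have "0 \<le> (r - 3 / 10) * (1 - r)" using assms by (intro mult_nonneg_nonneg) auto
  also have "(r - 3 / 10) * (1 - r) = 13 / 10 * r - 3 / 10 - r\<^sup>2"
    by (simp add: power2_eq_square field_simps)
  finally show False using assms \<open>\<not> r \<le> 3 / 10\<close> by linarith
qed

text \<open>
  The inequality of \<open>koebe_kernel_Re_bound\<close> in real terms: \<open>\<rho> = |w|\<close>, \<open>x = Re w\<close>, \<open>N = |1 + t w|\<^sup>2\<close>, and
  \<open>\<kappa>\<close> is the Schwarz-Pick bound for \<open>|z w' - w|\<close>; everything is multiplied by \<open>N\<^sup>2\<close>.  For
  \<open>t \<ge> 0\<close> a factor \<open>N\<close> splits off up to a nonnegative term.  For \<open>t < 0\<close> the expression is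
  increasing in \<open>x\<close>, and it remains to look at \<open>x = -\<rho>\<close>.  There, and for the monotonicity, the
  hypothesis \<open>r\<^sup>2 - 4 r + 1 \<ge> 0\<close> is exactly what is needed when \<open>t = -1\<close>.
\<close>
lemma koebe_kernel_inequality:
  fixes t r \<rho> x :: real
  assumes t: "\<bar>t\<bar> \<le> 1" and r: "r < 1" "0 \<le> r\<^sup>2 - 4 * r + 1" and \<rho>: "0 \<le> \<rho>" "\<rho> \<le> r" and x: "\<bar>x\<bar> \<le> \<rho>"
  defines "M \<equiv> r / (1 - t * r)\<^sup>2" and "\<kappa> \<equiv> (r\<^sup>2 - \<rho>\<^sup>2) / (1 - r\<^sup>2)" and "N \<equiv> 1 + 2 * t * x + t\<^sup>2 * \<rho>\<^sup>2"
  shows "0 \<le> M * N\<^sup>2 - \<kappa> * N + x * (1 + t\<^sup>2 * \<rho>\<^sup>2) + 2 * t * \<rho>\<^sup>2"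
proof -
  have r3: "r \<le> 3 / 10" using koebe_convexity_polynomial_bound r by blast
  have r0: "0 \<le> r" using \<rho> by simp
  have rr: "r\<^sup>2 \<le> r" using r0 r by (simp add: power2_eq_square mult_left_le_one_le)
  have r2: "0 < 1 - r\<^sup>2" using rr r by linarith
  have tr: "\<bar>t * r\<bar> \<le> r" using t r0 by (simp add: abs_mult mult_left_le_one_le)
  have den: "0 < 1 - t * r" using tr r by linarith
  have M0: "0 \<le> M" using r0 by (simp add: M_def)
  have \<kappa>: "\<kappa> = (r - \<rho>) * ((r + \<rho>) / (1 - r\<^sup>2))"
    by (simp add: \<kappa>_def power2_eq_square algebra_simps)
  have \<kappa>0: "0 \<le> \<kappa>" unfolding \<kappa> using \<rho> r2 by simp
  have tx: "\<bar>t * x\<bar> \<le> r"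
    using mult_mono[OF t x] \<rho> by (simp add: abs_mult)
  have "0 \<le> t\<^sup>2 * \<rho>\<^sup>2" by simp
  then have N0: "0 < N" unfolding N_def using tx r3 by linarith
  show ?thesis
  proof (cases "0 \<le> t")
    case True
    have "\<kappa> \<le> (r - \<rho>) * 1" unfolding \<kappa>
    proof (rule mult_left_mono)
      show "(r + \<rho>) / (1 - r\<^sup>2) \<le> 1" using \<rho> rr r3 r2 by (simp add: divide_le_eq)
    qed (use \<rho> in simp)
    moreover have "r \<le> M * N"
    proof -
      have "t * \<rho> \<le> t * r" using True \<rho> by (simp add: mult_left_mono)
      then have "(1 - t * r)\<^sup>2 \<le> (1 - t * \<rho>)\<^sup>2" using den by (intro power_mono) auto
      also have "\<dots> \<le> N"
      proof -
        have "0 \<le> 2 * t * (x + \<rho>)" using True x by simp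
        then show ?thesis by (simp add: N_def power2_eq_square algebra_simps)
      qed
      finally have "M * (1 - t * r)\<^sup>2 \<le> M * N" using M0 by (rule mult_left_mono)
      then show ?thesis using den by (simp add: M_def)
    qed
    moreover have "- \<rho> \<le> x" using x by simp
    ultimately have "0 \<le> N * (M * N - \<kappa> + x)" using N0 by (intro mult_nonneg_nonneg) auto
    moreover have "0 \<le> 2 * t * (\<rho>\<^sup>2 - x\<^sup>2)"
      using True x \<rho> abs_le_square_iff[of x \<rho>] by simp
    ultimately have "0 \<le> N * (M * N - \<kappa> + x) + 2 * t * (\<rho>\<^sup>2 - x\<^sup>2)" by simp
    also have "\<dots> = M * N\<^sup>2 - \<kappa> * N + x * (1 + t\<^sup>2 * \<rho>\<^sup>2) + 2 * t * \<rho>\<^sup>2"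
      by (simp add: N_def power2_eq_square algebra_simps)
    finally show ?thesis .
  next
    case False
    define s where "s = - t"
    have s: "0 \<le> s" "s \<le> 1" using False t by (auto simp: s_def)
    define k where "k = s * r"
    define p where "p = s * \<rho>"
    have pk: "0 \<le> p" "p \<le> k" "k \<le> r"
      using s \<rho> r0 by (auto simp: p_def k_def mult_left_mono mult_left_le_one_le)
    define N1 where "N1 = (1 + p)\<^sup>2"
    have MM: "M = r / (1 + k)\<^sup>2" by (simp add: M_def k_def s_def)
    have NN: "N = N1 - 2 * s * (x + \<rho>)"
      by (simp add: N_def N1_def p_def s_def power2_eq_square algebra_simps)
    have k1: "0 < (1 + k)\<^sup>2" using pk by simp
    have "0 \<le> (r - k) * (4 - r - k)" using pk r by (intro mult_nonneg_nonneg) auto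
    then have k4: "4 * k \<le> 1 + k\<^sup>2" using r(2) by (simp add: power2_eq_square algebra_simps)
    have "0 \<le> 2 * (k - p) * (1 - k * p)"
      using pk r mult_mono[of k 1 p 1] by (intro mult_nonneg_nonneg) auto
    then have "(1 + k\<^sup>2) * (1 + p)\<^sup>2 \<le> (1 + p\<^sup>2) * (1 + k)\<^sup>2"
      by (simp add: power2_eq_square algebra_simps)
    moreover have "4 * k * (1 + p)\<^sup>2 \<le> (1 + k\<^sup>2) * (1 + p)\<^sup>2"
      by (intro mult_right_mono k4) auto
    ultimately have "4 * k * (1 + p)\<^sup>2 / (1 + k)\<^sup>2 \<le> 1 + p\<^sup>2"
      using k1 by (simp add: pos_divide_le_eq)
    \<comment> \<open>controls the slope in \<open>x\<close> of the chord starting at \<open>-\<rho>\<close>\<close>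
    then have slope: "4 * s * M * N1 \<le> 1 + p\<^sup>2" by (simp add: MM N1_def k_def)
    \<comment> \<open>the value at \<open>x = -\<rho>\<close>, divided by \<open>N1\<close>\<close>
    have base: "0 \<le> M * N1 - \<kappa> - \<rho>"
    proof -
      have "(r + \<rho>) * (1 + k)\<^sup>2 \<le> (2 * r) * (1 + r)\<^sup>2"
        using \<rho> pk r0 by (intro mult_mono power_mono) auto
      also have "\<dots> \<le> (1 - r)\<^sup>2 * (1 + r)\<^sup>2"
      proof (rule mult_right_mono)
        show "2 * r \<le> (1 - r)\<^sup>2" using r(2) by (simp add: power2_eq_square algebra_simps)
      qed simp
      also have "\<dots> = (1 - r\<^sup>2) * (1 - r\<^sup>2)" by (simp add: power2_eq_square algebra_simps)
      also have "\<dots> \<le> (1 - k * p) * (1 - r\<^sup>2)"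
        using pk r2 mult_mono[of k r p r] r0 by (intro mult_right_mono) (auto simp: power2_eq_square)
      finally have "(r + \<rho>) / (1 - r\<^sup>2) \<le> (1 - k * p) / (1 + k)\<^sup>2"
        using r2 k1 by (simp add: divide_le_eq le_divide_eq field_simps)
      then have "\<kappa> \<le> (r - \<rho>) * ((1 - k * p) / (1 + k)\<^sup>2)"
        unfolding \<kappa> using \<rho> by (intro mult_left_mono) auto
      also have "(r - \<rho>) * ((1 - k * p) / (1 + k)\<^sup>2) = M * N1 - \<rho>"
      proof -
        have "(r - \<rho>) * ((1 - k * p) / (1 + k)\<^sup>2) = (r * (1 + p)\<^sup>2 - \<rho> * (1 + k)\<^sup>2) / (1 + k)\<^sup>2"
          unfolding times_divide_eq_right
          by (rule arg_cong[of _ _ "\<lambda>u. u / (1 + k)\<^sup>2"]) (simp add: k_def p_def power2_eq_square algebra_simps)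
        also have "\<dots> = M * N1 - \<rho>"
          using k1 by (simp add: MM N1_def diff_divide_distrib)
        finally show ?thesis .
      qed
      finally show ?thesis by simp
    qed
    have \<delta>: "0 \<le> x + \<rho>" using x by auto
    have "N \<le> N1" using NN s \<delta> by simp
    then have "2 * s * M * (N + N1) \<le> 2 * s * M * (N1 + N1)" using s M0 by (intro mult_left_mono) auto
    also have "\<dots> = 4 * s * M * N1" by simp
    also note slope
    finally have "0 \<le> - (2 * s * M * (N + N1)) + (1 + p\<^sup>2)" by simp
    moreover have "0 \<le> 2 * s * \<kappa>" using s \<kappa>0 by simp
    ultimately have "0 \<le> - 2 * s * M * (N + N1) + 2 * s * \<kappa> + (1 + p\<^sup>2)"
      unfolding mult_minus_left by linarith
    then have "0 \<le> (x + \<rho>) * (- 2 * s * M * (N + N1) + 2 * s * \<kappa> + (1 + p\<^sup>2))"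
      by (intro mult_nonneg_nonneg[OF \<delta>])
    moreover have "0 \<le> N1 * (M * N1 - \<kappa> - \<rho>)" using base by (simp add: N1_def)
    ultimately have "0 \<le> N1 * (M * N1 - \<kappa> - \<rho>) + (x + \<rho>) * (- 2 * s * M * (N + N1) + 2 * s * \<kappa> + (1 + p\<^sup>2))"
      by simp
    also have "\<dots> = M * N\<^sup>2 - \<kappa> * N + x * (1 + t\<^sup>2 * \<rho>\<^sup>2) + 2 * t * \<rho>\<^sup>2"
    proof -
      have t: "t = - s" by (simp add: s_def)
      show ?thesis unfolding NN t N1_def p_def by (simp add: power2_eq_square algebra_simps)
    qed
    finally show ?thesis .
  qed
qed

text \<open>
  The value \<open>-r/(1 - t r)\<^sup>2\<close> is the one at \<open>w = \<zeta> = -r\<close>.  In the application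
  \<open>\<zeta> = z w'(z)\<close>.
\<close>
lemma koebe_kernel_Re_bound:
  fixes t r :: real and w \<zeta> :: complex
  assumes t: "\<bar>t\<bar> \<le> 1" and r: "r < 1" "0 \<le> r\<^sup>2 - 4 * r + 1" and w: "cmod w \<le> r"
    and \<zeta>: "cmod (\<zeta> - w) * (1 - r\<^sup>2) \<le> r\<^sup>2 - (cmod w)\<^sup>2"
  shows "- (r / (1 - t * r)\<^sup>2) \<le> Re (\<zeta> / (1 + of_real t * w)\<^sup>2)"
proof -
  define D where "D = (1 + of_real t * w)\<^sup>2"
  define \<rho> where "\<rho> = cmod w"
  define N where "N = 1 + 2 * t * Re w + t\<^sup>2 * \<rho>\<^sup>2"
  define \<kappa> where "\<kappa> = (r\<^sup>2 - \<rho>\<^sup>2) / (1 - r\<^sup>2)"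
  have r0: "0 \<le> r" using w norm_ge_zero[of w] by linarith
  have r2: "0 < 1 - r\<^sup>2" using r r0 abs_square_less_1[of r] by simp
  have \<rho>2: "\<rho>\<^sup>2 = (Re w)\<^sup>2 + (Im w)\<^sup>2" by (simp add: \<rho>_def cmod_power2)
  have ND: "cmod D = N"
    unfolding D_def N_def norm_power \<rho>2 cmod_power2 by (simp add: power2_eq_square algebra_simps)
  have "cmod (of_real t * w) < 1"
    using mult_mono[OF t w] r r0 by (simp add: norm_mult)
  then have "1 + of_real t * w \<noteq> 0"
    by (metis add_eq_0_iff norm_minus_cancel norm_one less_irrefl)
  then have N: "0 < N" using ND D_def by (metis zero_less_norm_iff power_not_zero)
  have key: "0 \<le> r / (1 - t * r)\<^sup>2 * N\<^sup>2 - \<kappa> * N + Re w * (1 + t\<^sup>2 * \<rho>\<^sup>2) + 2 * t * \<rho>\<^sup>2"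
    unfolding N_def \<kappa>_def
    by (rule koebe_kernel_inequality[OF t r]) (use w abs_Re_le_cmod[of w] in \<open>auto simp: \<rho>_def\<close>)
  have Q: "Re (w / D) = (Re w * (1 + t\<^sup>2 * \<rho>\<^sup>2) + 2 * t * \<rho>\<^sup>2) / N\<^sup>2"
  proof -
    have "Re (w * cnj D) = Re w * (1 + t\<^sup>2 * \<rho>\<^sup>2) + 2 * t * \<rho>\<^sup>2"
      unfolding D_def \<rho>2 by (simp add: power2_eq_square algebra_simps)
    moreover have "w / D = w * cnj D / of_real (N\<^sup>2)"
      unfolding ND[symmetric] by (rule complex_div_cnj)
    ultimately show ?thesis by (simp only: Re_divide_of_real)
  qed
  have "cmod (\<zeta> - w) \<le> \<kappa>" using \<zeta> r2 by (simp add: \<kappa>_def \<rho>_def pos_le_divide_eq)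
  then have "cmod ((\<zeta> - w) / D) \<le> \<kappa> / N" using N by (simp add: norm_divide ND divide_right_mono)
  then have "- (\<kappa> / N) \<le> Re ((\<zeta> - w) / D)"
    using abs_Re_le_cmod[of "(\<zeta> - w) / D"] by linarith
  moreover have "Re (\<zeta> / D) = Re (w / D) + Re ((\<zeta> - w) / D)"
    by (simp flip: plus_complex.sel add_divide_distrib)
  moreover have "- (r / (1 - t * r)\<^sup>2) \<le> Re (w / D) - \<kappa> / N"
  proof -
    have "0 \<le> (r / (1 - t * r)\<^sup>2 * N\<^sup>2 - \<kappa> * N + Re w * (1 + t\<^sup>2 * \<rho>\<^sup>2) + 2 * t * \<rho>\<^sup>2) / N\<^sup>2"
      using key by simp
    also have "\<dots> = r / (1 - t * r)\<^sup>2 - \<kappa> / N + Re (w / D)"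
      unfolding Q using N by (simp add: add_divide_distrib diff_divide_distrib power2_eq_square)
    finally show ?thesis by linarith
  qed
  ultimately show ?thesis by (simp add: D_def)
qed

lemma one_minus_mult_pos:
  fixes t u :: real
  assumes "\<bar>t\<bar> \<le> 1" "\<bar>u\<bar> < 1"
  shows "0 < 1 - t * u"
proof -
  have "\<bar>t * u\<bar> \<le> 1 * \<bar>u\<bar>" unfolding abs_mult using assms by (intro mult_right_mono) auto
  then show ?thesis using assms by auto
qed

text \<open>
  Both sides are integrals over \<open>t\<close> from \<open>B\<close> to \<open>A\<close> of the two sides of \<open>koebe_kernel_Re_bound\<close>,
  with antiderivatives \<open>-r t/(1 - t r)\<close> and the real part of
  \<open>\<zeta> t/(1 + t w)\<close>.  The minimisers for the different \<open>t\<close>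
  coincide, so the integrated bound is still attained.
\<close>
lemma mobius_kernel_Re_bound:
  fixes A B r :: real and w \<zeta> :: complex
  assumes AB: "-1 \<le> B" "B < A" "A \<le> 1" and r: "r < 1" "0 \<le> r\<^sup>2 - 4 * r + 1" and w: "cmod w \<le> r"
    and \<zeta>: "cmod (\<zeta> - w) * (1 - r\<^sup>2) \<le> r\<^sup>2 - (cmod w)\<^sup>2"
  shows "- ((A - B) * r / ((1 - A * r) * (1 - B * r))) \<le>
    Re (of_real (A - B) * \<zeta> / ((1 + of_real A * w) * (1 + of_real B * w)))"
proof -
  have r0: "0 \<le> r" using w norm_ge_zero[of w] by linarith
  have nz: "1 - t * r \<noteq> 0" "1 + of_real t * w \<noteq> 0" if t: "\<bar>t\<bar> \<le> 1" for t
  proof -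
    have "\<bar>t * r\<bar> < 1" using mult_mono[OF t order_refl, of r] r r0 by (simp add: abs_mult)
    then show "1 - t * r \<noteq> 0" by auto
    have "cmod (of_real t * w) < 1" using mult_mono[OF t w] r r0 by (simp add: norm_mult)
    then show "1 + of_real t * w \<noteq> 0"
      by (metis add_eq_0_iff norm_minus_cancel norm_one less_irrefl)
  qed
  define G where "G t = Re (\<zeta> * of_real t / (1 + of_real t * w)) + r * t / (1 - t * r)" for t
  have "G B \<le> G A"
  proof (rule DERIV_nonneg_imp_nondecreasing[where f = G])
    fix t assume "B \<le> t" "t \<le> A"
    then have t: "\<bar>t\<bar> \<le> 1" using AB by auto
    have "((\<lambda>u. \<zeta> * u / (1 + u * w)) has_field_derivative
        (\<zeta> * 1 * (1 + of_real t * w) - \<zeta> * of_real t * (1 * w)) / ((1 + of_real t * w) * (1 + of_real t * w))) (at (of_real t))"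
      by (rule derivative_eq_intros refl | use nz(2)[OF t] in simp)+
    then have "((\<lambda>u. \<zeta> * u / (1 + u * w)) has_field_derivative \<zeta> / (1 + of_real t * w)\<^sup>2) (at (of_real t))"
      by (simp add: power2_eq_square algebra_simps)
    from bounded_linear.has_vector_derivative[OF bounded_linear_Re has_vector_derivative_real_field[OF this]]
    have 1: "((\<lambda>t. Re (\<zeta> * of_real t / (1 + of_real t * w))) has_real_derivative
        Re (\<zeta> / (1 + of_real t * w)\<^sup>2)) (at t)"
      by (simp add: has_real_derivative_iff_has_vector_derivative)
    have "((\<lambda>t. r * t / (1 - t * r)) has_real_derivative
        (r * 1 * (1 - t * r) - r * t * (- r)) / ((1 - t * r) * (1 - t * r))) (at t)"
      by (rule derivative_eq_intros refl | use nz(1)[OF t] in simp)+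
    then have 2: "((\<lambda>t. r * t / (1 - t * r)) has_real_derivative r / (1 - t * r)\<^sup>2) (at t)"
      by (simp add: power2_eq_square algebra_simps)
    show "\<exists>y. (G has_real_derivative y) (at t) \<and> 0 \<le> y"
      unfolding G_def
      using DERIV_add[OF 1 2] koebe_kernel_Re_bound[OF t r w \<zeta>] by force
  qed (use AB in simp)
  moreover have "Re (\<zeta> * of_real A / (1 + of_real A * w)) - Re (\<zeta> * of_real B / (1 + of_real B * w)) =
      Re (of_real (A - B) * \<zeta> / ((1 + of_real A * w) * (1 + of_real B * w)))"
    using nz(2)[of A] nz(2)[of B] AB
    by (subst minus_complex.sel(1)[symmetric], intro arg_cong[of _ _ Re]) (simp add: field_simps)
  moreover have "r * A / (1 - A * r) - r * B / (1 - B * r) = (A - B) * r / ((1 - A * r) * (1 - B * r))"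
    using nz(1)[of A] nz(1)[of B] AB by (simp add: field_simps)
  ultimately show ?thesis unfolding G_def by linarith
qed

lemma class_PAB_log_derivative_bound:
  assumes AB: "-1 \<le> B" "B < A" "A \<le> 1" and f: "f \<in> class_PAB A B" and z: "z \<in> unit_disk"
    and r: "0 \<le> (cmod z)\<^sup>2 - 4 * cmod z + 1"
  shows "- ((A - B) * cmod z / ((1 - A * cmod z) * (1 - B * cmod z))) \<le> Re (z * deriv f z / f z)"
proof -
  obtain w where w: "w holomorphic_on unit_disk" "w 0 = 0" "\<And>z. z \<in> unit_disk \<Longrightarrow> cmod (w z) \<le> 1"
    and fw: "\<And>z. z \<in> unit_disk \<Longrightarrow> f z = (1 + of_real A * w z) / (1 + of_real B * w z)"
    using f by (auto simp: class_PAB_def subordinate_def)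
  have z1: "cmod z < 1" using z by simp
  note sw = schwarz_function_deriv[OF w z]
  have nz: "1 + of_real t * w z \<noteq> 0" if t: "\<bar>t\<bar> \<le> 1" for t :: real
  proof -
    have "cmod (of_real t * w z) < 1" using mult_mono[OF t sw(1)] z1 by (simp add: norm_mult)
    then show "1 + of_real t * w z \<noteq> 0"
      by (metis add_eq_0_iff norm_minus_cancel norm_one less_irrefl)
  qed
  note nzA = nz[of A] and nzB = nz[of B]
  have dw: "(w has_field_derivative deriv w z) (at z)"
    by (rule holomorphic_derivI[OF w(1) open_ball z])
  have "((\<lambda>z. (1 + of_real A * w z) / (1 + of_real B * w z)) has_field_derivative
      (of_real A * deriv w z * (1 + of_real B * w z) - (1 + of_real A * w z) * (of_real B * deriv w z)) /
      ((1 + of_real B * w z) * (1 + of_real B * w z))) (at z)"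
    by (rule derivative_eq_intros dw refl | use nzB AB in simp)+
  then have "(f has_field_derivative
      (of_real A * deriv w z * (1 + of_real B * w z) - (1 + of_real A * w z) * (of_real B * deriv w z)) /
      ((1 + of_real B * w z) * (1 + of_real B * w z))) (at z)"
    by (rule has_field_derivative_transform_within_open[OF _ open_ball z]) (simp add: fw)
  then have "deriv f z = of_real (A - B) * deriv w z / ((1 + of_real B * w z) * (1 + of_real B * w z))"
    by (simp add: DERIV_imp_deriv algebra_simps)
  moreover have "z * (c * d / (Y * Y)) / (X / Y) = c * (z * d) / (X * Y)" if "X \<noteq> 0" "Y \<noteq> 0" for c d X Y :: complex
    using that by (simp add: field_simps)
  ultimately have "z * deriv f z / f z = of_real (A - B) * (z * deriv w z) / ((1 + of_real A * w z) * (1 + of_real B * w z))"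
    using nzA nzB AB fw[OF z] by simp
  then show ?thesis
    using mobius_kernel_Re_bound[OF AB z1 r sw] by simp
qed

section \<open>The radius and its sharpness\<close>

text \<open>
  The first term is \<open>3/(1 + r) - 1/(1 - r) - 1\<close>, and \<open>r/((1 - A r)(1 - B r))\<close> increases because
  \<open>|A B r s| \<le> 1\<close>.
\<close>
lemma convexity_expression_strict_decreasing:
  fixes A B r s :: real
  assumes AB: "-1 \<le> B" "B < A" "A \<le> 1" and r: "0 \<le> r" "r < s" "s < 1"
  shows "(s\<^sup>2 - 4 * s + 1) / (1 - s\<^sup>2) - (A - B) * s / ((1 - A * s) * (1 - B * s)) <
    (r\<^sup>2 - 4 * r + 1) / (1 - r\<^sup>2) - (A - B) * r / ((1 - A * r) * (1 - B * r))"
proof -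
  have k: "(u\<^sup>2 - 4 * u + 1) / (1 - u\<^sup>2) = 3 / (1 + u) - 1 / (1 - u) - 1" if "0 \<le> u" "u < 1" for u :: real
  proof -
    have den: "1 - u\<^sup>2 = (1 + u) * (1 - u)" by (simp add: power2_eq_square algebra_simps)
    have nz: "1 + u \<noteq> 0" "1 - u \<noteq> 0" using that by auto
    have "3 / x - 1 / y - 1 = 3 * y / (x * y) - x / (x * y) - (x * y) / (x * y)"
      if "x \<noteq> 0" "y \<noteq> 0" for x y :: real
      using that by simp
    from this[OF nz] have "3 / (1 + u) - 1 / (1 - u) - 1 =
        3 * (1 - u) / ((1 + u) * (1 - u)) - (1 + u) / ((1 + u) * (1 - u)) - ((1 + u) * (1 - u)) / ((1 + u) * (1 - u))" .
    also have "\<dots> = (u\<^sup>2 - 4 * u + 1) / ((1 + u) * (1 - u))"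
      unfolding diff_divide_distrib[symmetric]
      by (rule arg_cong[of _ _ "\<lambda>v. v / ((1 + u) * (1 - u))"]) (simp add: power2_eq_square algebra_simps)
    finally show ?thesis unfolding den by simp
  qed
  have "3 / (1 + s) < 3 / (1 + r)" "1 / (1 - r) < 1 / (1 - s)"
    using r by (auto intro!: divide_strict_left_mono mult_pos_pos)
  moreover have "(A - B) * r / ((1 - A * r) * (1 - B * r)) \<le> (A - B) * s / ((1 - A * s) * (1 - B * s))"
  proof -
    have p: "0 < (1 - A * r) * (1 - B * r)" "0 < (1 - A * s) * (1 - B * s)"
      using AB r by (intro mult_pos_pos one_minus_mult_pos; simp)+
    have "0 \<le> (s - r) * (1 - (A * r) * (B * s))"
    proof (rule mult_nonneg_nonneg)
      have "\<bar>A * r\<bar> \<le> 1" "\<bar>B * s\<bar> \<le> 1"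
        using AB r by (auto simp: abs_mult intro!: mult_le_one)
      then have "\<bar>A * r\<bar> * \<bar>B * s\<bar> \<le> 1" by (intro mult_le_one) auto
      then show "0 \<le> 1 - (A * r) * (B * s)" by (simp add: abs_le_iff flip: abs_mult)
    qed (use r in simp)
    then have "r * ((1 - A * s) * (1 - B * s)) \<le> s * ((1 - A * r) * (1 - B * r))"
      by (simp add: algebra_simps)
    then have "r / ((1 - A * r) * (1 - B * r)) \<le> s / ((1 - A * s) * (1 - B * s))"
    proof -
      have "x / P \<le> y / Q" if "0 < P" "0 < Q" "x * Q \<le> y * P" for x y P Q :: real
        using that by (simp add: divide_simps mult.commute)
      then show ?thesis using p \<open>r * _ \<le> _\<close> by blast
    qed
    from mult_left_mono[OF this, of "A - B"] show ?thesis using AB by simp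
  qed
  ultimately show ?thesis using k[of r] k[of s] r by linarith
qed

text \<open>
  The intermediate value theorem applies on the interval up to \<open>3/10\<close>, a point beyond \<open>2 - \<surd>3\<close>, where the
  left-hand side of the equation is already negative.
\<close>
lemma radius_root_unique:
  assumes AB: "-1 \<le> B" "B < A" "A \<le> 1" and \<alpha>: "0 \<le> \<alpha>" "\<alpha> < 1"
  shows "\<exists>!r. radius_root A B \<alpha> r"
proof (rule ex_ex1I)
  let ?\<Phi> = "\<lambda>r. (r\<^sup>2 - 4 * r + 1) / (1 - r\<^sup>2) - (A - B) * r / ((1 - A * r) * (1 - B * r))"
  have "continuous_on {0..3 / 10} ?\<Phi>"
  proof (intro continuous_intros ballI)
    fix u :: real assume u: "u \<in> {0..3 / 10}"
    have "0 < (1 - A * u) * (1 - B * u)" using AB u by (intro mult_pos_pos one_minus_mult_pos) auto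
    then show "(1 - A * u) * (1 - B * u) \<noteq> 0" by (metis less_irrefl)
    have "u\<^sup>2 < 1" using u abs_square_less_1[of u] by auto
    then show "1 - u\<^sup>2 \<noteq> 0" by simp
  qed
  moreover have "?\<Phi> (3 / 10) \<le> \<alpha>"
  proof -
    have "0 \<le> (A - B) * (3 / 10) / ((1 - A * (3 / 10)) * (1 - B * (3 / 10)))"
      using AB by (intro divide_nonneg_pos mult_nonneg_nonneg mult_pos_pos one_minus_mult_pos) auto
    moreover have "((3 / 10)\<^sup>2 - 4 * (3 / 10) + 1) / (1 - (3 / 10)\<^sup>2) \<le> (0::real)" by (simp add: power2_eq_square)
    ultimately show ?thesis using \<alpha> by linarith
  qed
  moreover have "\<alpha> \<le> ?\<Phi> 0" using \<alpha> by simp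
  ultimately obtain r where r: "0 \<le> r" "r \<le> 3 / 10" "?\<Phi> r = \<alpha>"
    using IVT2'[of ?\<Phi> "3 / 10" \<alpha> 0] by auto
  have "r \<noteq> 0" using r(3) \<alpha> by auto
  then show "\<exists>r. radius_root A B \<alpha> r"
    using r by (intro exI[of _ r]) (auto simp: radius_root_def)
  fix r s assume rs: "radius_root A B \<alpha> r" "radius_root A B \<alpha> s"
  show "r = s"
    using convexity_expression_strict_decreasing[OF AB, of r s] convexity_expression_strict_decreasing[OF AB, of s r] rs
    by (cases r s rule: linorder_cases) (auto simp: radius_root_def)
qed

lemma volterra_convexity_expression:
  assumes f: "f holomorphic_on unit_disk" and g: "g holomorphic_on unit_disk" and z: "z \<in> unit_disk"
    and nz: "f z \<noteq> 0" "deriv g z \<noteq> 0"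
  shows "deriv (volterra g f) z \<noteq> 0"
    and "1 + z * deriv (deriv (volterra g f)) z / deriv (volterra g f) z =
      (1 + z * deriv (deriv g) z / deriv g z) + z * deriv f z / f z"
proof -
  have d: "deriv (volterra g f) y = f y * deriv g y" if "y \<in> unit_disk" for y
    by (rule DERIV_imp_deriv[OF volterra_has_field_derivative[OF f g that]])
  have "((\<lambda>y. f y * deriv g y) has_field_derivative deriv f z * deriv g z + deriv (deriv g) z * f z) (at z)"
    by (intro DERIV_mult holomorphic_derivI[OF f open_ball z]
        holomorphic_derivI[OF holomorphic_deriv[OF g open_ball] open_ball z])
  then have "(deriv (volterra g f) has_field_derivative deriv f z * deriv g z + deriv (deriv g) z * f z) (at z)"
    by (rule has_field_derivative_transform_within_open[OF _ open_ball z]) (simp add: d)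
  then have dd: "deriv (deriv (volterra g f)) z = deriv f z * deriv g z + deriv (deriv g) z * f z"
    by (rule DERIV_imp_deriv)
  show "deriv (volterra g f) z \<noteq> 0" using nz by (simp add: d[OF z])
  show "1 + z * deriv (deriv (volterra g f)) z / deriv (volterra g f) z =
      (1 + z * deriv (deriv g) z / deriv g z) + z * deriv f z / f z"
    unfolding d[OF z] dd using nz by (simp add: field_simps)
qed

text \<open>
  The real part is positive because \<open>Re ((1 - A z) cnj (1 - B z))\<close> is affine in \<open>Re z\<close> for fixed \<open>|z|\<close>,
  and at \<open>Re z = \<plusminus>|z|\<close> it is a product of two positive factors.
\<close>
lemma mobius_mem_class_PAB:
  assumes AB: "-1 \<le> B" "B < A" "A \<le> 1"
  shows "(\<lambda>z. (1 - of_real A * z) / (1 - of_real B * z)) \<in> class_PAB A B"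
proof -
  have nz: "1 - of_real B * z \<noteq> 0" if "z \<in> unit_disk" for z :: complex
  proof
    assume "1 - of_real B * z = 0"
    then have "cmod (of_real B * z) = 1" by simp
    then have "\<bar>B\<bar> * cmod z = 1" by (simp add: norm_mult)
    moreover have "\<bar>B\<bar> * cmod z \<le> 1 * cmod z" using AB by (intro mult_right_mono) auto
    ultimately show False using that by simp
  qed
  have "0 < Re ((1 - of_real A * z) / (1 - of_real B * z))" if z: "z \<in> unit_disk" for z :: complex
  proof -
    have "0 < Re ((1 - of_real A * z) * cnj (1 - of_real B * z))"
    proof -
      let ?\<rho> = "cmod z"
      have "Re ((1 - of_real A * z) * cnj (1 - of_real B * z)) = 1 + A * B * ?\<rho>\<^sup>2 - (A + B) * Re z"
        unfolding cmod_power2 by (simp add: power2_eq_square algebra_simps)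
      moreover have "(A + B) * Re z \<le> \<bar>A + B\<bar> * ?\<rho>"
      proof -
        have "(A + B) * Re z \<le> \<bar>A + B\<bar> * \<bar>Re z\<bar>" unfolding abs_mult[symmetric] by simp
        also have "\<dots> \<le> \<bar>A + B\<bar> * ?\<rho>" by (intro mult_left_mono abs_Re_le_cmod) simp
        finally show ?thesis .
      qed
      moreover have "\<bar>A + B\<bar> * ?\<rho> < 1 + A * B * ?\<rho>\<^sup>2"
      proof -
        have abs: "\<bar>A\<bar> \<le> 1" "\<bar>B\<bar> \<le> 1" "\<bar>?\<rho>\<bar> < 1" "\<bar>- ?\<rho>\<bar> < 1" using AB z by auto
        have p: "0 < (1 - A * ?\<rho>) * (1 - B * ?\<rho>)" "0 < (1 - A * - ?\<rho>) * (1 - B * - ?\<rho>)"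
          by (intro mult_pos_pos one_minus_mult_pos abs)+
        have e: "(1 - A * u) * (1 - B * u) = 1 + A * B * u\<^sup>2 - (A + B) * u" for u :: real
          by (simp add: power2_eq_square algebra_simps)
        have "0 < 1 + A * B * ?\<rho>\<^sup>2 - (A + B) * ?\<rho>" "0 < 1 + A * B * ?\<rho>\<^sup>2 + (A + B) * ?\<rho>"
          using p[unfolded e] by simp_all
        moreover have "\<bar>x\<bar> * y = x * y \<or> \<bar>x\<bar> * y = - (x * y)" for x y :: real
          by (simp add: abs_if)
        note this[of "A + B" ?\<rho>]
        ultimately show ?thesis by linarith
      qed
      ultimately show ?thesis by linarith
    qed
    moreover have "(1 - of_real A * z) / (1 - of_real B * z) =
        (1 - of_real A * z) * cnj (1 - of_real B * z) / of_real ((cmod (1 - of_real B * z))\<^sup>2)"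
      by (rule complex_div_cnj)
    ultimately show ?thesis using nz[OF z] by (simp only: Re_divide_of_real) simp
  qed
  moreover have "(\<lambda>z. (1 - of_real A * z) / (1 - of_real B * z)) holomorphic_on unit_disk"
    by (intro holomorphic_intros nz)
  moreover have "(\<lambda>z. (1 - of_real A * z) / (1 - of_real B * z)) \<prec> (\<lambda>z. (1 + of_real A * z) / (1 + of_real B * z))"
    unfolding subordinate_def by (intro exI[of _ uminus]) (auto intro!: holomorphic_intros)
  ultimately show ?thesis by (simp add: class_PAB_def class_P_def)
qed

text \<open>
  The Koebe function \<open>z/(1 - z)\<^sup>2\<close> rotated so that its extremal radius is the positive one.
\<close>
lemma koebe_mem_class_U:
  defines "k \<equiv> \<lambda>z::complex. z / (1 + z)\<^sup>2"
  shows "k \<in> class_U"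
    and "z \<in> unit_disk \<Longrightarrow> deriv k z = (1 - z) / (1 + z) ^ 3"
    and "z \<in> unit_disk \<Longrightarrow> deriv (deriv k) z = (2 * z - 4) / (1 + z) ^ 4"
proof -
  have nz: "1 + y \<noteq> 0" if "y \<in> unit_disk" for y
    using that by (metis add_eq_0_iff dist_0_norm less_irrefl mem_ball norm_minus_cancel norm_one)
  have "k holomorphic_on unit_disk"
    unfolding k_def by (intro holomorphic_intros) (use nz in auto)
  have dk: "deriv k y = (1 - y) / (1 + y) ^ 3" if y: "y \<in> unit_disk" for y
  proof (rule DERIV_imp_deriv)
    have "(k has_field_derivative (1 * (1 + y)\<^sup>2 - y * (2 * (1 + y))) / ((1 + y)\<^sup>2 * (1 + y)\<^sup>2)) (at y)"
      unfolding k_def by (rule derivative_eq_intros refl | use nz[OF y] in simp)+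
    moreover have "(1 * x\<^sup>2 - y * (2 * x)) / (x\<^sup>2 * x\<^sup>2) = (x - 2 * y) / x ^ 3" if "x \<noteq> 0" for x :: complex
      using that by (simp add: frac_eq_eq power2_eq_square power3_eq_cube algebra_simps)
    note this[OF nz[OF y]]
    moreover have "1 + y - 2 * y = 1 - y" by simp
    ultimately show "(k has_field_derivative (1 - y) / (1 + y) ^ 3) (at y)"
      by (simp only:)
  qed
  show "z \<in> unit_disk \<Longrightarrow> deriv k z = (1 - z) / (1 + z) ^ 3" by (rule dk)
  show "deriv (deriv k) z = (2 * z - 4) / (1 + z) ^ 4" if z: "z \<in> unit_disk"
  proof (rule DERIV_imp_deriv)
    have "((\<lambda>z. (1 - z) / (1 + z) ^ 3) has_field_derivative
       (- 1 * (1 + z) ^ 3 - (1 - z) * (3 * (1 + z)\<^sup>2)) / ((1 + z) ^ 3 * (1 + z) ^ 3)) (at z)"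
      by (rule derivative_eq_intros refl | use nz[OF z] in simp)+
    moreover have "(- 1 * x ^ 3 - a * (3 * x\<^sup>2)) / (x ^ 3 * x ^ 3) = (- x - 3 * a) / x ^ 4"
      if "x \<noteq> 0" for x a :: complex
      using that by (simp add: frac_eq_eq power2_eq_square power3_eq_cube power4_eq_xxxx algebra_simps)
    note this[OF nz[OF z], of "1 - z"]
    moreover have "- (1 + z) - 3 * (1 - z) = 2 * z - 4" by simp
    ultimately have "((\<lambda>z. (1 - z) / (1 + z) ^ 3) has_field_derivative (2 * z - 4) / (1 + z) ^ 4) (at z)"
      by (simp only:)
    then show "(deriv k has_field_derivative (2 * z - 4) / (1 + z) ^ 4) (at z)"
      by (rule has_field_derivative_transform_within_open[OF _ open_ball z]) (simp add: dk)
  qed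
  have "inj_on k unit_disk"
  proof (rule inj_onI)
    fix z w assume zw: "z \<in> unit_disk" "w \<in> unit_disk" "k z = k w"
    then have "z * (1 + w)\<^sup>2 = w * (1 + z)\<^sup>2"
      using nz by (simp add: k_def frac_eq_eq)
    then have "(z - w) * (1 - z * w) = 0" by (simp add: power2_eq_square algebra_simps)
    moreover have "cmod (z * w) < 1" using norm_mult_less[of z 1 w 1] zw by simp
    then have "1 - z * w \<noteq> 0" by (metis eq_iff_diff_eq_0 less_irrefl norm_one)
    ultimately show "z = w" by simp
  qed
  then show "k \<in> class_U"
    using \<open>k holomorphic_on unit_disk\<close> dk[of 0] by (simp add: class_U_def class_A_def k_def)
qed

theorem theorem3p3:
  fixes A B \<alpha> :: real
  assumes "-1 \<le> B" and "B < A" and "A \<le> 1" and "0 \<le> \<alpha>" and "\<alpha> < 1"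
  shows "(\<exists>!r. radius_root A B \<alpha> r) \<and>
    (\<forall>f\<in>class_PAB A B. \<forall>g\<in>class_U.
       convex_of_order_in \<alpha> (radius_c A B \<alpha>) (volterra g f)) \<and>
    (\<forall>R>radius_c A B \<alpha>. \<not> (\<forall>f\<in>class_PAB A B. \<forall>g\<in>class_U.
       convex_of_order_in \<alpha> R (volterra g f)))"
proof (intro conjI ballI allI impI)
  note AB = assms(1-3)
  define \<rho> where "\<rho> = radius_c A B \<alpha>"
  show ex1: "\<exists>!r. radius_root A B \<alpha> r" by (rule radius_root_unique[OF assms])
  have root: "radius_root A B \<alpha> \<rho>"
    unfolding \<rho>_def radius_c_def by (rule theI'[OF ex1])
  then have \<rho>: "0 < \<rho>" "\<rho> < 1"
    and \<rho>_eq: "(\<rho>\<^sup>2 - 4 * \<rho> + 1) / (1 - \<rho>\<^sup>2) - (A - B) * \<rho> / ((1 - A * \<rho>) * (1 - B * \<rho>)) = \<alpha>"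
    by (auto simp: radius_root_def)
  show "convex_of_order_in \<alpha> (radius_c A B \<alpha>) (volterra g f)"
    if f: "f \<in> class_PAB A B" and g: "g \<in> class_U" for f g
    unfolding convex_of_order_in_def
  proof (intro ballI)
    fix z :: complex assume "z \<in> ball 0 (radius_c A B \<alpha>)"
    then have r: "cmod z < \<rho>" by (simp add: \<rho>_def)
    then have z: "z \<in> unit_disk" using \<rho> by simp
    have hf: "f holomorphic_on unit_disk" "f z \<noteq> 0"
      using f z by (force simp: class_PAB_def class_P_def)+
    have hg: "g holomorphic_on unit_disk" "inj_on g unit_disk"
      using g by (auto simp: class_U_def class_A_def)
    have dg: "deriv g z \<noteq> 0"
      by (rule holomorphic_injective_imp_regular[OF hg(1) open_ball hg(2) z])
    note expr = volterra_convexity_expression[OF hf(1) hg(1) z hf(2) dg]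
    have gt: "\<alpha> < ((cmod z)\<^sup>2 - 4 * cmod z + 1) / (1 - (cmod z)\<^sup>2) -
        (A - B) * cmod z / ((1 - A * cmod z) * (1 - B * cmod z))"
      using convexity_expression_strict_decreasing[OF AB norm_ge_zero r \<rho>(2)] \<rho>_eq by simp
    moreover have "0 \<le> (A - B) * cmod z / ((1 - A * cmod z) * (1 - B * cmod z))"
      using AB z by (intro divide_nonneg_pos mult_nonneg_nonneg mult_pos_pos one_minus_mult_pos) auto
    ultimately have "0 < ((cmod z)\<^sup>2 - 4 * cmod z + 1) / (1 - (cmod z)\<^sup>2)"
      using assms(4) by linarith
    moreover have "0 < 1 - (cmod z)\<^sup>2" using z abs_square_less_1[of "cmod z"] by simp
    ultimately have "0 \<le> (cmod z)\<^sup>2 - 4 * cmod z + 1" by (simp add: zero_less_divide_iff)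
    from class_PAB_log_derivative_bound[OF AB f z this] univalent_convexity_bound[OF hg z] gt
    show "deriv (volterra g f) z \<noteq> 0 \<and> \<alpha> < Re (1 + z * deriv (deriv (volterra g f)) z / deriv (volterra g f) z)"
      unfolding expr(2) using expr(1) by simp
  qed
  \<comment> \<open>for the extremal pair the expression equals \<open>\<alpha>\<close> at the real point \<open>\<rho>\<close>, so the strict inequality fails there\<close>
  fix R assume R: "radius_c A B \<alpha> < R"
  define f where "f = (\<lambda>z. (1 - complex_of_real A * z) / (1 - of_real B * z))"
  define g where "g = (\<lambda>z::complex. z / (1 + z)\<^sup>2)"
  define z where "z = complex_of_real \<rho>"
  have z: "z \<in> unit_disk" "z \<in> ball 0 R" using \<rho> R by (auto simp: z_def \<rho>_def)
  have f: "f \<in> class_PAB A B" unfolding f_def by (rule mobius_mem_class_PAB[OF AB])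
  have g: "g \<in> class_U" unfolding g_def by (rule koebe_mem_class_U(1))
  have nz: "1 - A * \<rho> \<noteq> 0" "1 - B * \<rho> \<noteq> 0" "1 - \<rho> \<noteq> 0" "1 + \<rho> \<noteq> 0"
    using one_minus_mult_pos[of A \<rho>] one_minus_mult_pos[of B \<rho>] AB \<rho> by (auto simp: abs_le_iff)
  have "1 - of_real A * z = of_real (1 - A * \<rho>)" "1 - of_real B * z = of_real (1 - B * \<rho>)"
    "1 - z = of_real (1 - \<rho>)" "1 + z = of_real (1 + \<rho>)"
    by (simp_all add: z_def)
  with nz have nzc: "1 - of_real A * z \<noteq> 0" "1 - of_real B * z \<noteq> 0" "1 - z \<noteq> 0" "1 + z \<noteq> 0"
    by (simp_all only: of_real_eq_0_iff not_False_eq_True)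
  have "((\<lambda>z. (1 - complex_of_real A * z) / (1 - of_real B * z)) has_field_derivative
      (- of_real A * (1 - of_real B * z) - (1 - of_real A * z) * (- of_real B)) / ((1 - of_real B * z) * (1 - of_real B * z))) (at z)"
    by (rule derivative_eq_intros refl | use nzc in simp)+
  then have df: "deriv f z = - of_real (A - B) / ((1 - of_real B * z) * (1 - of_real B * z))"
    unfolding f_def by (simp add: DERIV_imp_deriv algebra_simps)
  have fz: "f z = (1 - of_real A * z) / (1 - of_real B * z)"
    by (simp add: f_def)
  have dg: "deriv g z = (1 - z) / (1 + z) ^ 3" "deriv (deriv g) z = (2 * z - 4) / (1 + z) ^ 4"
    unfolding g_def using koebe_mem_class_U(2,3) z(1) by auto
  have "1 + z * deriv (deriv g) z / deriv g z = of_real ((\<rho>\<^sup>2 - 4 * \<rho> + 1) / (1 - \<rho>\<^sup>2))"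
  proof -
    have "1 + z * (c / x ^ 4) / (y / x ^ 3) = (y * x + z * c) / (y * x)"
      if "x \<noteq> 0" "y \<noteq> 0" for x y c :: complex
      using that by (simp add: field_simps power3_eq_cube power4_eq_xxxx)
    from this[OF nzc(4,3)] have "1 + z * ((2 * z - 4) / (1 + z) ^ 4) / ((1 - z) / (1 + z) ^ 3) =
        ((1 - z) * (1 + z) + z * (2 * z - 4)) / ((1 - z) * (1 + z))" .
    also have "\<dots> = (z\<^sup>2 - 4 * z + 1) / (1 - z\<^sup>2)"
      by (rule arg_cong2[of _ _ _ _ "(/)"]) (simp_all add: power2_eq_square algebra_simps)
    also have "\<dots> = of_real ((\<rho>\<^sup>2 - 4 * \<rho> + 1) / (1 - \<rho>\<^sup>2))" by (simp add: z_def)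
    finally show ?thesis unfolding dg .
  qed
  moreover have "z * deriv f z / f z = - of_real ((A - B) * \<rho> / ((1 - A * \<rho>) * (1 - B * \<rho>)))"
  proof -
    have "z * deriv f z / f z = - (of_real (A - B) * z / ((1 - of_real A * z) * (1 - of_real B * z)))"
    proof -
      have "z * (- c / (Y * Y)) / (X / Y) = - (c * z / (X * Y))" if "X \<noteq> 0" "Y \<noteq> 0" for c X Y :: complex
        using that by (simp add: field_simps)
      from this[OF nzc(1,2)] show ?thesis by (simp only: df fz)
    qed
    then show ?thesis by (simp add: z_def)
  qed
  moreover have hol: "f holomorphic_on unit_disk" "g holomorphic_on unit_disk"
    using f g by (auto simp: class_PAB_def class_P_def class_U_def class_A_def)
  moreover have "f z \<noteq> 0" using nzc by (simp add: f_def)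
  moreover have "deriv g z \<noteq> 0"
    using holomorphic_injective_imp_regular[OF hol(2) open_ball _ z(1)] g by (simp add: class_U_def)
  ultimately have "1 + z * deriv (deriv (volterra g f)) z / deriv (volterra g f) z = of_real \<alpha>"
    using volterra_convexity_expression(2)[OF _ _ z(1)] \<rho>_eq[symmetric] by simp
  then have "Re (1 + z * deriv (deriv (volterra g f)) z / deriv (volterra g f) z) = \<alpha>"
    by (simp only: Re_complex_of_real)
  then have "\<not> convex_of_order_in \<alpha> R (volterra g f)"
    unfolding convex_of_order_in_def using z(2) by (metis less_irrefl)
  then show "\<not> (\<forall>f\<in>class_PAB A B. \<forall>g\<in>class_U. convex_of_order_in \<alpha> R (volterra g f))"
    using f g by blast
qed

end
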